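(* If $J(\lambda)<\infty$ then: (1) The optimal cost of the LQ problem \[ \max_{w\in \mathcal{L}_2[0,T]} \int_0^T \begin{bmatrix} x_a(t) \\ w(t) \end{bmatrix}^\top \begin{bmatrix} Q(t,\lambda) & S(t,\lambda) \\ S(t,\lambda)^\top & R(t,\lambda) \end{bmatrix} \begin{bmatrix} x_a(t) \\ w(t) \end{bmatrix} dt \quad\text{s.t. } \dot{x}_a = A_a x_a + B_a w,\ x_a(0)=\begin{bmatrix} 0 \\ 1 \end{bmatrix} \] is equal to $J(\lambda)$. (2) The optimal cost is achieved by $(x_a^*,w^* )$ satisfying, with $x_a^*(0) =\begin{bmatrix} 0 \\ 1 \end{bmatrix}$, \[ \dot{x}_a^* = \left(A_a-B_a R^{-1} ( Y B_a +S )^\top \right) x_a^*, \qquad w^* = -R^{-1} ( Y B_a +S )^\top x_a^*, \] where $Y$ is the solution to $\dot{Y} + A_a^\top Y + Y A_a + Q - (Y B_a + S) R^{-1} (Y B_a + S)^\top = 0$ with $Y(T)=0$. (3) $J$ satisfies the subgradient inequality $J(\alpha) \ge J(\lambda) + g^\top (\alpha-\lambda)$ for all $\alpha \in \mathbb{R}^m$, where $g\in \mathbb{R}^m$ is defined by \[ g_i := \int_0^T \begin{bmatrix} x_a^*(t) \\ w^*(t) \end{bmatrix}^\top \begin{bmatrix} Q_i(t) & S_i(t) \\ S_i(t)^\top & R_i(t) \end{bmatrix} \begin{bmatrix} x_a^*(t) \\ w^*(t) \end{bmatrix} dt . \]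
   Context: Finite horizon $T<\infty$. Augmented LTV system: $\dot{x}_a = A_a x_a + B_a w$, $v = C_{v,a} x_a + D_{vw} w$, $\delta_e = C_{e,a} x_a + D_{ew} w$, $x_a(t)\in\mathbb{R}^{n_x+1}$, all matrices continuous in time. Given IQC matrices $\{M_i\}_{i=1}^m$, define $\begin{bmatrix} Q_0 & S_0\\ S_0^\top & R_0\end{bmatrix} := \begin{bmatrix} C_{e,a} & D_{ew}\end{bmatrix}^\top\begin{bmatrix} C_{e,a} & D_{ew}\end{bmatrix}$, $\begin{bmatrix} Q_i & S_i\\ S_i^\top & R_i\end{bmatrix} := \begin{bmatrix} C_{v,a} & D_{vw}\\ 0 & I\end{bmatrix}^\top M_i \begin{bmatrix} C_{v,a} & D_{vw}\\ 0 & I\end{bmatrix}$, and $(Q,S,R)(t,\lambda)$ as $(Q_0,S_0,R_0)+\sum_i\lambda_i(Q_i,S_i,R_i)$, with $R(t,\lambda)\prec 0$ assumed. $J(\lambda)$ is the infimum over differentiable $P:[0,T]\to\mathbb{S}^{n_x+1}$ of $\begin{bmatrix}0\\1\end{bmatrix}^\top P(0)\begin{bmatrix}0\\1\end{bmatrix}$ subject to $P(T)\succeq 0$ and $\begin{bmatrix} \dot{P} + A_a^\top P + P A_a & P B_a \\ B_a^\top P & 0 \end{bmatrix} + \begin{bmatrix} Q & S \\ S^\top & R \end{bmatrix} \prec 0$ for all $t\in[0,T]$ ($+\infty$ if infeasible). When $J(\lambda)<\infty$, the Riccati equation above with $Y(T)=0$ has a solution on $[0,T]$ and $J(\lambda)=\begin{bmatrix}0\\1\end{bmatrix}^\top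 Y(0)\begin{bmatrix}0\\1\end{bmatrix}$. *)

theory Defs
  imports "HOL-Analysis.Analysis"
begin

definition blk :: "real^('c::finite)^('a::finite) \<Rightarrow> real^('d::finite)^'a \<Rightarrow> real^'c^('b::finite) \<Rightarrow> real^'d^'b \<Rightarrow> real^('c+'d)^('a+'b)" where
  "blk P Q R S = (\<chi> i j. case i of
       Inl a \<Rightarrow> (case j of Inl c \<Rightarrow> P$a$c | Inr d \<Rightarrow> Q$a$d)
     | Inr b \<Rightarrow> (case j of Inl c \<Rightarrow> R$b$c | Inr d \<Rightarrow> S$b$d))"

definition hcat :: "real^('c::finite)^('a::finite) \<Rightarrow> real^('d::finite)^'a \<Rightarrow> real^('c+'d)^'a" where
  "hcat C D = (\<chi> i j. case j of Inl c \<Rightarrow> C$i$c | Inr d \<Rightarrow> D$i$d)"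

definition blk11 :: "real^(('c::finite)+('d::finite))^(('a::finite)+('b::finite)) \<Rightarrow> real^'c^'a" where
  "blk11 N = (\<chi> a c. N$(Inl a)$(Inl c))"
definition blk12 :: "real^(('c::finite)+('d::finite))^(('a::finite)+('b::finite)) \<Rightarrow> real^'d^'a" where
  "blk12 N = (\<chi> a d. N$(Inl a)$(Inr d))"
definition blk22 :: "real^(('c::finite)+('d::finite))^(('a::finite)+('b::finite)) \<Rightarrow> real^'d^'b" where
  "blk22 N = (\<chi> b d. N$(Inr b)$(Inr d))"

definition stack :: "real^('a::finite) \<Rightarrow> real^('b::finite) \<Rightarrow> real^('a+'b)" where
  "stack x w = (\<chi> i. case i of Inl a \<Rightarrow> x$a | Inr b \<Rightarrow> w$b)"

definition neg_def :: "real^('n::finite)^'n \<Rightarrow> bool" where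
  "neg_def N \<longleftrightarrow> (\<forall>z. z \<noteq> 0 \<longrightarrow> z \<bullet> (N *v z) < 0)"

definition psd :: "real^('n::finite)^'n \<Rightarrow> bool" where
  "psd N \<longleftrightarrow> (\<forall>z. 0 \<le> z \<bullet> (N *v z))"

definition x0a :: "real^(('x::finite)+unit)" where
  "x0a = (\<chi> i. case i of Inl _ \<Rightarrow> 0 | Inr _ \<Rightarrow> 1)"

definition W0 :: "(real \<Rightarrow> real^('s::finite)^('e::finite)) \<Rightarrow> (real \<Rightarrow> real^('w::finite)^'e) \<Rightarrow> real \<Rightarrow> real^('s+'w)^('s+'w)" where
  "W0 Cea Dew t = transpose (hcat (Cea t) (Dew t)) ** hcat (Cea t) (Dew t)"

definition Wi :: "(real \<Rightarrow> real^('s::finite)^('v::finite)) \<Rightarrow> (real \<Rightarrow> real^('w::finite)^'v) \<Rightarrow> (('m::finite) \<Rightarrow> real^('v+'w)^('v+'w))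
                 \<Rightarrow> 'm \<Rightarrow> real \<Rightarrow> real^('s+'w)^('s+'w)" where
  "Wi Cva Dvw M i t = transpose (blk (Cva t) (Dvw t) 0 (mat 1)) ** M i ** blk (Cva t) (Dvw t) 0 (mat 1)"

definition Wlam :: "(real \<Rightarrow> real^('s::finite)^('e::finite)) \<Rightarrow> (real \<Rightarrow> real^('w::finite)^'e) \<Rightarrow> (real \<Rightarrow> real^'s^('v::finite)) \<Rightarrow> (real \<Rightarrow> real^'w^'v)
      \<Rightarrow> (('m::finite) \<Rightarrow> real^('v+'w)^('v+'w)) \<Rightarrow> real^'m \<Rightarrow> real \<Rightarrow> real^('s+'w)^('s+'w)" where
  "Wlam Cea Dew Cva Dvw M lam t = W0 Cea Dew t + (\<Sum>i\<in>UNIV. (lam $ i) *\<^sub>R Wi Cva Dvw M i t)"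

definition lmi_feasible :: "real \<Rightarrow> (real \<Rightarrow> real^('s::finite)^'s) \<Rightarrow> (real \<Rightarrow> real^('w::finite)^'s)
      \<Rightarrow> (real \<Rightarrow> real^('s+'w)^('s+'w)) \<Rightarrow> (real \<Rightarrow> real^'s^'s) \<Rightarrow> bool" where
  "lmi_feasible T Aa Ba W P \<longleftrightarrow>
     (\<exists>P'. (\<forall>t\<in>{0..T}. (P has_vector_derivative P' t) (at t within {0..T}))
        \<and> (\<forall>t\<in>{0..T}. transpose (P t) = P t)
        \<and> psd (P T)
        \<and> (\<forall>t\<in>{0..T}. neg_def
              (blk (P' t + transpose (Aa t) ** P t + P t ** Aa t) (P t ** Ba t)
                   (transpose (Ba t) ** P t) 0 + W t)))"

definition Jval :: "real \<Rightarrow> (real \<Rightarrow> real^(('x::finite)+unit)^('x+unit)) \<Rightarrow> (real \<Rightarrow> real^('w::finite)^('x+unit))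
      \<Rightarrow> (real \<Rightarrow> real^(('x+unit)+'w)^(('x+unit)+'w)) \<Rightarrow> ereal" where
  "Jval T Aa Ba W = Inf {ereal (x0a \<bullet> (P 0 *v x0a)) | P. lmi_feasible T Aa Ba W P}"

definition riccati_sol :: "real \<Rightarrow> (real \<Rightarrow> real^('s::finite)^'s) \<Rightarrow> (real \<Rightarrow> real^('w::finite)^'s)
      \<Rightarrow> (real \<Rightarrow> real^('s+'w)^('s+'w)) \<Rightarrow> (real \<Rightarrow> real^'s^'s) \<Rightarrow> bool" where
  "riccati_sol T Aa Ba W Y \<longleftrightarrow> Y T = 0 \<and>
     (\<forall>t\<in>{0..T}. (Y has_vector_derivative
        (- (transpose (Aa t) ** Y t + Y t ** Aa t + blk11 (W t)
            - (Y t ** Ba t + blk12 (W t)) ** matrix_inv (blk22 (W t)) ** transpose (Y t ** Ba t + blk12 (W t)))))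
        (at t within {0..T}))"

text \<open>w in L2[0,T], x the (Caratheodory) solution of xdot = Aa x + Ba w, x(0) = x0.\<close>
definition lq_traj :: "real \<Rightarrow> (real \<Rightarrow> real^('s::finite)^'s) \<Rightarrow> (real \<Rightarrow> real^('w::finite)^'s) \<Rightarrow> real^'s
      \<Rightarrow> (real \<Rightarrow> real^'s) \<Rightarrow> (real \<Rightarrow> real^'w) \<Rightarrow> bool" where
  "lq_traj T Aa Ba xinit x w \<longleftrightarrow>
     w measurable_on {0..T} \<and> (\<lambda>t. (norm (w t))\<^sup>2) integrable_on {0..T}
     \<and> (\<lambda>s. Aa s *v x s + Ba s *v w s) integrable_on {0..T}
     \<and> (\<forall>t\<in>{0..T}. x t = xinit + integral {0..t} (\<lambda>s. Aa s *v x s + Ba s *v w s))"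

definition lq_cost :: "real \<Rightarrow> (real \<Rightarrow> real^(('s::finite)+('w::finite))^('s+'w)) \<Rightarrow> (real \<Rightarrow> real^'s) \<Rightarrow> (real \<Rightarrow> real^'w) \<Rightarrow> real" where
  "lq_cost T W x w = integral {0..T} (\<lambda>t. stack (x t) (w t) \<bullet> (W t *v stack (x t) (w t)))"

end

theory Submission
  imports Defs
begin

text \<open>
  The Riccati equation is solved by linearisation: for the Hamiltonian flow \<open>(X, L)\<close> with
  \<open>X T = I\<close>, \<open>L T = 0\<close>, the matrix \<open>Y = L X\<^sup>-\<^sup>1\<close> is a solution wherever \<open>X\<close> is invertible.
  If \<open>X t\<^sub>0 \<xi> = 0\<close>, put \<open>x = X \<xi>\<close> and \<open>l = L \<xi>\<close>; strict feasibility of some \<open>P\<close> makes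
  \<open>x \<bullet> P x - x \<bullet> l\<close> nonincreasing, zero at \<open>t\<^sub>0\<close> and nonnegative at \<open>T\<close>, hence constant on
  \<open>[t\<^sub>0, T]\<close>, which contradicts strictness at \<open>T\<close> unless \<open>\<xi> = 0\<close>.

  Completing the square gives cost \<open>= x\<^sub>0 \<bullet> Y(0) x\<^sub>0 + \<integral> (w + K x) \<bullet> R (w + K x)\<close>, so \<open>w = - K x\<close> is optimal.
  Integrating the LMI along this trajectory gives \<open>x\<^sub>0 \<bullet> Y(0) x\<^sub>0 \<le> x\<^sub>0 \<bullet> P(0) x\<^sub>0\<close> for every feasible \<open>P\<close>, and
  \<open>(1 - \<epsilon>) Y + \<epsilon> P\<close> is feasible because the LMI is affine in \<open>P\<close> and holds weakly for \<open>Y\<close>; hence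
  \<open>J(\<lambda>) = x\<^sub>0 \<bullet> Y(0) x\<^sub>0\<close>. The subgradient inequality is the LMI bound for \<open>\<alpha>\<close> along the
  trajectory that is optimal for \<open>\<lambda>\<close>, because the cost is affine in the multiplier.
\<close>

section \<open>Matrices and block forms\<close>

lemma bounded_bilinear_matrix_vector_mult:
  "bounded_bilinear ((*v) :: real^'n::finite^'m::finite \<Rightarrow> real^'n \<Rightarrow> real^'m)"
  unfolding bilinear_conv_bounded_bilinear[symmetric] bilinear_def
  by (auto intro!: linearI simp: matrix_vector_right_distrib matrix_vector_mult_add_rdistrib
      matrix_vector_mult_scaleR scaleR_matrix_vector_assoc)

lemma bounded_bilinear_matrix_matrix_mult:
  "bounded_bilinear ((**) :: real^'n::finite^'m::finite \<Rightarrow> real^'k::finite^'n \<Rightarrow> real^'k^'m)"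
  unfolding bilinear_conv_bounded_bilinear[symmetric] bilinear_def
  by (auto intro!: linearI simp: matrix_matrix_mult_def vec_eq_iff algebra_simps sum.distrib
      sum_distrib_left)

lemma bounded_linear_transpose:
  "bounded_linear (transpose :: real^'n::finite^'m::finite \<Rightarrow> real^'m^'n)"
  unfolding linear_conv_bounded_linear[symmetric]
  by (auto intro!: linearI simp: transpose_def vec_eq_iff)

lemma inner_matrix_vector_transpose:
  fixes A :: "real^'n::finite^'m::finite"
  shows "x \<bullet> (A *v y) = (transpose A *v x) \<bullet> y"
  by (simp add: dot_lmul_matrix)

lemma sum_UNIV_Plus:
  "(\<Sum>i\<in>(UNIV :: ('a::finite + 'b::finite) set). f i) = (\<Sum>a\<in>UNIV. f (Inl a)) + (\<Sum>b\<in>UNIV. f (Inr b))"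
  by (simp add: sum.Plus flip: UNIV_Plus_UNIV)

lemma inner_stack: "stack x w \<bullet> stack y v = x \<bullet> y + w \<bullet> v"
  by (simp add: stack_def inner_vec_def sum_UNIV_Plus)

lemma stack_eq_0: "stack x w = 0 \<longleftrightarrow> x = 0 \<and> w = 0"
  by (subst inner_eq_zero_iff[symmetric]) (simp add: inner_stack add_nonneg_eq_0_iff)

lemma stack_exhaust: obtains x w where "z = stack x w"
proof
  show "z = stack (\<chi> a. z $ Inl a) (\<chi> b. z $ Inr b)"
    by (auto simp: stack_def vec_eq_iff split: sum.split)
qed

lemma bounded_linear_stack: "bounded_linear (\<lambda>p. stack (fst p) (snd p))"
  unfolding linear_conv_bounded_linear[symmetric]
  by (auto intro!: linearI simp: stack_def vec_eq_iff split: sum.split)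

lemma blk_mult_stack: "blk P Q R S *v stack x w = stack (P *v x + Q *v w) (R *v x + S *v w)"
  by (auto simp: blk_def stack_def vec_eq_iff matrix_vector_mult_def sum_UNIV_Plus split: sum.split)

text \<open>Symmetry makes the lower-left block the transpose of \<open>blk12\<close>, so the three
  blocks \<open>blk11\<close>, \<open>blk12\<close> and \<open>blk22\<close> determine the whole
  matrix.\<close>

lemma symmetric_mult_stack:
  assumes "transpose N = N"
  shows "N *v stack x w
    = stack (blk11 N *v x + blk12 N *v w) (transpose (blk12 N) *v x + blk22 N *v w)"
proof -
  have "N $ i $ j = N $ j $ i" for i j
    by (subst assms[symmetric]) (simp add: transpose_def)
  then show ?thesis
    by (auto simp: blk11_def blk12_def blk22_def stack_def vec_eq_iff matrix_vector_mult_def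
        transpose_def sum_UNIV_Plus split: sum.split)
qed

lemma symmetric_blk:
  assumes "transpose N = N"
  shows "transpose (blk11 N) = blk11 N" "transpose (blk22 N) = blk22 N"
proof -
  have "N $ i $ j = N $ j $ i" for i j
    by (subst assms[symmetric]) (simp add: transpose_def)
  then show "transpose (blk11 N) = blk11 N" "transpose (blk22 N) = blk22 N"
    by (auto simp: blk11_def blk22_def transpose_def vec_eq_iff)
qed

lemma neg_def_invertible:
  assumes "neg_def N" shows "invertible N"
proof -
  have "N *v z \<noteq> 0" if "z \<noteq> 0" for z
    using assms that unfolding neg_def_def by force
  then show ?thesis
    by (metis invertible_left_inverse matrix_left_invertible_ker)
qed

lemma
  assumes "invertible (N :: real^'n::finite^'n)"
  shows matrix_inv_right_mult: "N ** matrix_inv N = mat 1"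
    and matrix_inv_left_mult: "matrix_inv N ** N = mat 1"
  using someI_ex[OF assms[unfolded invertible_def]] unfolding matrix_inv_def by auto

lemma transpose_matrix_inv:
  assumes "invertible (N :: real^'n::finite^'n)" "transpose N = N"
  shows "transpose (matrix_inv N) = matrix_inv N"
proof -
  have "transpose (matrix_inv N) ** N = mat 1"
    by (metis assms matrix_inv_right_mult matrix_transpose_mul transpose_mat)
  then show ?thesis
    by (metis assms(1) matrix_inv_right_mult matrix_mul_assoc matrix_mul_lid matrix_mul_rid)
qed

section \<open>Continuity and differentiability of the matrix inverse\<close>

lemma continuous_on_vec_componentwise:
  assumes "\<And>i. continuous_on S (\<lambda>t. f t $ i)"
  shows "continuous_on S f"
  using continuous_on_vec_lambda[of S "\<lambda>i t. f t $ i"] assms by simp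

lemma continuous_on_det:
  fixes A :: "'a::topological_space \<Rightarrow> real^'n::finite^'n"
  assumes "continuous_on S A"
  shows "continuous_on S (\<lambda>t. det (A t))"
  unfolding det_def by (intro continuous_intros assms)

text \<open>By Cramer's rule each entry of the inverse is a quotient of two determinants, and
  determinants are polynomials in the entries.\<close>

lemma continuous_on_matrix_inv:
  fixes A :: "'a::topological_space \<Rightarrow> real^'n::finite^'n"
  assumes c: "continuous_on S A" and inv: "\<And>t. t \<in> S \<Longrightarrow> invertible (A t)"
  shows "continuous_on S (\<lambda>t. matrix_inv (A t))"
proof (intro continuous_on_vec_componentwise)
  fix i j
  \<comment> \<open>The numerator in Cramer's rule: column \<open>i\<close> of \<open>A t\<close> is
    replaced by the \<open>j\<close>-th unit vector.\<close>
  define N where "N t = (\<chi> k l. if l = i then axis j 1 $ k else A t $ k $ l)" for t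
  have "matrix_inv (A t) $ i $ j = det (N t) / det (A t)" if t: "t \<in> S" for t
  proof -
    have "A t *v (matrix_inv (A t) *v axis j 1) = axis j 1"
      by (simp add: matrix_vector_mul_assoc matrix_inv_right_mult[OF inv[OF t]])
    then have "matrix_inv (A t) *v axis j 1
        = (\<chi> k. det (\<chi> m l. if l = k then axis j 1 $ m else A t $ m $ l) / det (A t))"
      by (subst (asm) cramer) (use inv[OF t] invertible_det_nz in auto)
    moreover have "matrix_inv (A t) $ i $ j = (matrix_inv (A t) *v axis j 1) $ i"
      by (simp add: matrix_vector_mult_basis column_def)
    ultimately show ?thesis by (simp add: N_def)
  qed
  moreover have "continuous_on S (\<lambda>t. det (N t) / det (A t))"
  proof (intro continuous_intros continuous_on_det c)
    have "continuous_on S (\<lambda>t. N t $ k $ l)" for k l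
      by (cases "l = i") (auto simp: N_def intro!: continuous_intros c)
    then show "continuous_on S N" by (intro continuous_on_vec_componentwise)
  qed (use inv invertible_det_nz in auto)
  ultimately show "continuous_on S (\<lambda>t. matrix_inv (A t) $ i $ j)"
    by (simp cong: continuous_on_cong)
qed

lemma has_vector_derivative_iff_tendsto:
  "(f has_vector_derivative d) (at t within S)
    \<longleftrightarrow> ((\<lambda>s. (f s - f t) /\<^sub>R (s - t)) \<longlongrightarrow> d) (at t within S)"
proof -
  have "norm (f s - f t - (s - t) *\<^sub>R d) / norm (s - t) = norm ((f s - f t) /\<^sub>R (s - t) - d)"
    if "s \<noteq> t" for s
  proof -
    have "(f s - f t) /\<^sub>R (s - t) - d = (f s - f t - (s - t) *\<^sub>R d) /\<^sub>R (s - t)"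
      using that by (simp add: scaleR_diff_right)
    then show ?thesis by (simp add: divide_inverse mult.commute)
  qed
  then have "((\<lambda>s. norm (f s - f t - (s - t) *\<^sub>R d) / norm (s - t)) \<longlongrightarrow> 0) (at t within S)
      \<longleftrightarrow> ((\<lambda>s. norm ((f s - f t) /\<^sub>R (s - t) - d)) \<longlongrightarrow> 0) (at t within S)"
    by (intro filterlim_cong) (auto simp: eventually_at_filter)
  then show ?thesis
    unfolding has_vector_derivative_def has_derivative_iff_norm
    by (simp add: bounded_linear_scaleR_left tendsto_norm_zero_iff LIM_zero_iff)
qed

text \<open>The identity A(s)^-1 (A(s) - A(t)) A(t)^-1 = A(t)^-1 - A(s)^-1 rewrites the difference
  quotient of the inverse as minus a product, whose limit follows from continuity of the
  inverse.\<close>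

lemma has_vector_derivative_matrix_inv:
  fixes A :: "real \<Rightarrow> real^'n::finite^'n"
  assumes d: "\<And>t. t \<in> S \<Longrightarrow> (A has_vector_derivative A' t) (at t within S)"
    and inv: "\<And>t. t \<in> S \<Longrightarrow> invertible (A t)" and t: "t \<in> S"
  shows "((\<lambda>t. matrix_inv (A t)) has_vector_derivative - (matrix_inv (A t) ** A' t ** matrix_inv (A t))) (at t within S)"
proof -
  interpret bounded_bilinear "(**) :: real^'n^'n \<Rightarrow> real^'n^'n \<Rightarrow> real^'n^'n"
    by (rule bounded_bilinear_matrix_matrix_mult)
  let ?I = "\<lambda>t. matrix_inv (A t)"
  have "continuous_on S A"
    using d by (meson has_vector_derivative_continuous continuous_on_eq_continuous_within)
  then have "continuous_on S ?I" using inv by (rule continuous_on_matrix_inv)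
  then have I: "(?I \<longlongrightarrow> ?I t) (at t within S)" using t by (simp add: continuous_on_def)
  have A: "((\<lambda>s. (A s - A t) /\<^sub>R (s - t)) \<longlongrightarrow> A' t) (at t within S)"
    using d[OF t] by (simp add: has_vector_derivative_iff_tendsto)
  have eq: "(?I s - ?I t) /\<^sub>R (s - t) = - (?I s ** ((A s - A t) /\<^sub>R (s - t)) ** ?I t)" if "s \<in> S" for s
  proof -
    have "?I s ** (A s - A t) ** ?I t = ?I t - ?I s"
      by (simp add: diff_left diff_right matrix_inv_left_mult inv that t
        matrix_mul_assoc[symmetric] matrix_inv_right_mult)
    then show ?thesis
      by (simp only: scaleR_left scaleR_right scaleR_minus_right[symmetric] minus_diff_eq)
  qed
  have "((\<lambda>s. - (?I s ** ((A s - A t) /\<^sub>R (s - t)) ** ?I t)) \<longlongrightarrow> - (?I t ** A' t ** ?I t)) (at t within S)"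
    by (intro tendsto_minus tendsto I A tendsto_const)
  then show ?thesis
    unfolding has_vector_derivative_iff_tendsto
    by (rule Lim_transform_eventually) (simp add: eventually_at_filter eq)
qed

text \<open>This rule turns \<open>transpose A *v x\<close> into a product with a row vector; from
  here on adjoints stay in the form that \<open>inner_matrix_vector_transpose\<close>
  produces.\<close>

declare transpose_matrix_vector [simp del]

lemma bounded_linear_blk11: "bounded_linear blk11"
  and bounded_linear_blk12: "bounded_linear blk12"
  and bounded_linear_blk22: "bounded_linear blk22"
  unfolding linear_conv_bounded_linear[symmetric] blk11_def blk12_def blk22_def
  by (auto intro!: linearI simp: vec_eq_iff)

lemmas continuous_on_matrix_intros =
  bounded_bilinear.continuous_on[OF bounded_bilinear_matrix_vector_mult]
  bounded_bilinear.continuous_on[OF bounded_bilinear_matrix_matrix_mult]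
  bounded_linear.continuous_on[OF bounded_linear_transpose]
  bounded_linear.continuous_on[OF bounded_linear_blk11]
  bounded_linear.continuous_on[OF bounded_linear_blk12]
  bounded_linear.continuous_on[OF bounded_linear_blk22]

lemma continuous_on_stack:
  "continuous_on S x \<Longrightarrow> continuous_on S w \<Longrightarrow> continuous_on S (\<lambda>t. stack (x t) (w t))"
  using bounded_linear.continuous_on[OF bounded_linear_stack, of S "\<lambda>t. (x t, w t)"]
  by (simp add: continuous_on_Pair)

lemma symmetric_inner:
  fixes N :: "real^'n::finite^'n"
  shows "transpose N = N \<Longrightarrow> x \<bullet> (N *v y) = (N *v x) \<bullet> y"
  by (simp add: inner_matrix_vector_transpose)

lemma transpose_mult_add_vector:
  fixes Y :: "real^'n::finite^'n"
  assumes "transpose Y = Y"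
  shows "transpose (Y ** B + S) *v v = transpose B *v (Y *v v) + transpose S *v v"
  by (simp add: linear_add[OF bounded_linear.linear[OF bounded_linear_transpose]] matrix_transpose_mul
      assms matrix_vector_mult_add_rdistrib matrix_vector_mul_assoc)

lemma symmetric_stack_form:
  assumes "transpose N = N"
  shows "stack x w \<bullet> (N *v stack x w)
    = x \<bullet> (blk11 N *v x) + 2 * (x \<bullet> (blk12 N *v w)) + w \<bullet> (blk22 N *v w)"
  using inner_matrix_vector_transpose[of w "transpose (blk12 N)" x]
  by (simp add: symmetric_mult_stack[OF assms] inner_stack inner_add_right inner_commute)

lemma has_vector_derivative_imp_continuous_on:
  assumes "\<And>t. t \<in> S \<Longrightarrow> (f has_vector_derivative f' t) (at t within S)"
  shows "continuous_on S f"
  using assms by (meson has_vector_derivative_continuous continuous_on_eq_continuous_within)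

section \<open>Linear differential equations and indefinite integrals\<close>

lemma antimono_from_vector_derivative:
  fixes f :: "real \<Rightarrow> real"
  assumes d: "\<And>t. t \<in> {a..b} \<Longrightarrow> (f has_vector_derivative f' t) (at t within {a..b})"
    and le: "\<And>t. t \<in> {a..b} \<Longrightarrow> f' t \<le> 0"
    and st: "a \<le> s" "s \<le> t" "t \<le> b"
  shows "f t \<le> f s"
proof (rule DERIV_nonpos_imp_decreasing_open[OF st(2)])
  fix x assume x: "s < x" "x < t"
  then have "(f has_vector_derivative f' x) (at x)"
    using d[of x] st by (simp add: at_within_Icc_at)
  then show "\<exists>y. (f has_real_derivative y) (at x) \<and> y \<le> 0"
    using le[of x] x st by (auto simp: has_real_derivative_iff_has_vector_derivative)
next
  have "continuous_on {a..b} f"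
    using d by (meson has_vector_derivative_continuous continuous_on_eq_continuous_within)
  then show "continuous_on {s..t} f"
    by (rule continuous_on_subset) (use st in auto)
qed

text \<open>A backward Gronwall argument, used as uniqueness for terminal data:
  \<open>exp (2 * L * t) * (D t \<bullet> D t)\<close> is nondecreasing, nonnegative and zero at
  \<open>T\<close>. Its negative \<open>f\<close> fits the monotonicity lemma above.\<close>

lemma zero_of_derivative_bound:
  fixes D :: "real \<Rightarrow> 'a::real_inner"
  assumes d: "\<And>t. t \<in> {0..T} \<Longrightarrow> (D has_vector_derivative D' t) (at t within {0..T})"
    and le: "\<And>t. t \<in> {0..T} \<Longrightarrow> norm (D' t) \<le> L * norm (D t)"
    and DT: "D T = 0" and t: "t \<in> {0..T}"
  shows "D t = 0"
proof -
  define f where "f t = - (exp (2 * L * t) * (D t \<bullet> D t))" for t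
  have f: "(f has_vector_derivative - (exp (2 * L * s) * (2 * (D s \<bullet> D' s) + 2 * L * (D s \<bullet> D s)))) (at s within {0..T})"
    if s: "s \<in> {0..T}" for s
  proof -
    have "((\<lambda>t. exp (2 * L * t)) has_vector_derivative (2 * L * exp (2 * L * s))) (at s within {0..T})"
      unfolding has_real_derivative_iff_has_vector_derivative[symmetric]
      by (auto intro!: derivative_eq_intros)
    from bounded_bilinear.has_vector_derivative[OF bounded_bilinear_mult this
        bounded_bilinear.has_vector_derivative[OF bounded_bilinear_inner d[OF s] d[OF s]]]
    show ?thesis unfolding f_def
      by (rule has_vector_derivative_minus[THEN has_vector_derivative_eq_rhs])
        (simp add: inner_commute algebra_simps)
  qed
  have "f T \<le> f t"
  proof (rule antimono_from_vector_derivative[OF f])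
    fix s assume s: "s \<in> {0..T}"
    have "- (D s \<bullet> D' s) \<le> norm (D s) * norm (D' s)"
      using Cauchy_Schwarz_ineq2[of "D s" "D' s"] by linarith
    also have "\<dots> \<le> norm (D s) * (L * norm (D s))"
      by (rule mult_left_mono[OF le[OF s]]) simp
    also have "\<dots> = L * (D s \<bullet> D s)"
      by (simp add: dot_square_norm power2_eq_square)
    finally have "0 \<le> 2 * (D s \<bullet> D' s) + 2 * L * (D s \<bullet> D s)" by simp
    then show "- (exp (2 * L * s) * (2 * (D s \<bullet> D' s) + 2 * L * (D s \<bullet> D s))) \<le> 0" by simp
  qed (use t in auto)
  then show ?thesis using DT
    by (simp add: f_def mult_le_0_iff) (meson exp_gt_zero inner_eq_zero_iff inner_ge_zero not_le order_antisym)
qed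

section \<open>Linear differential equations with continuous coefficients\<close>

lemma continuous_on_linear_family:
  fixes F :: "real \<Rightarrow> 'a::euclidean_space \<Rightarrow> 'b::real_normed_vector"
  assumes lin: "\<And>t. t \<in> S \<Longrightarrow> linear (F t)"
    and cont: "\<And>v. continuous_on S (\<lambda>t. F t v)"
    and u: "continuous_on S u"
  shows "continuous_on S (\<lambda>t. F t (u t))"
proof -
  have "continuous_on S (\<lambda>t. \<Sum>b\<in>Basis. (u t \<bullet> b) *\<^sub>R F t b)"
    by (intro continuous_intros u cont)
  moreover have "(\<Sum>b\<in>Basis. (u t \<bullet> b) *\<^sub>R F t b) = F t (u t)" if "t \<in> S" for t
    by (subst (2) euclidean_representation[of "u t", symmetric])
      (simp add: linear_sum[OF lin[OF that]] linear_scale[OF lin[OF that]])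
  ultimately show ?thesis by (simp cong: continuous_on_cong)
qed

text \<open>As in the previous lemma, expansion in \<open>Basis\<close> reduces everything to
  finitely many fixed vectors, on each of which a continuous function on a compact set is
  bounded.\<close>

lemma linear_family_bound:
  fixes F :: "real \<Rightarrow> 'a::euclidean_space \<Rightarrow> 'b::real_normed_vector"
  assumes lin: "\<And>t. t \<in> S \<Longrightarrow> linear (F t)"
    and cont: "\<And>v. continuous_on S (\<lambda>t. F t v)" and S: "compact S"
  obtains L where "L > 0" "\<And>t v. t \<in> S \<Longrightarrow> norm (F t v) \<le> L * norm v"
proof -
  have "\<exists>c>0. \<forall>t\<in>S. norm (F t v) \<le> c" for v
    using compact_imp_bounded[OF compact_continuous_image[OF cont[of v] S]]
    unfolding bounded_pos by auto
  then obtain c where c: "\<And>v. c v > 0" "\<And>v t. t \<in> S \<Longrightarrow> norm (F t v) \<le> c v" by metis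
  show ?thesis
  proof
    show "(\<Sum>b\<in>Basis. c (b::'a)) > 0" by (intro sum_pos c) auto
    fix t v assume t: "t \<in> S"
    have "F t v = (\<Sum>b\<in>Basis. (v \<bullet> b) *\<^sub>R F t b)"
      by (subst euclidean_representation[of v, symmetric])
        (simp only: linear_sum[OF lin[OF t]] linear_scale[OF lin[OF t]])
    also have "norm \<dots> \<le> (\<Sum>b\<in>Basis. norm v * c b)"
      by (intro sum_norm_le) (auto intro!: mult_mono c Basis_le_norm t)
    finally show "norm (F t v) \<le> (\<Sum>b\<in>Basis. c b) * norm v"
      by (simp add: sum_distrib_left mult.commute)
  qed
qed

text \<open>Picard iteration arranged as a series: as \<open>F t\<close> is linear, the increments
  of the iterates obey the same recursion, the factorial bound makes the series of derivatives
  converge uniformly, and term by term differentiation gives the solution.\<close>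

lemma linear_ode_exists:
  fixes F :: "real \<Rightarrow> 'a::euclidean_space \<Rightarrow> 'a"
  assumes T: "0 \<le> T"
    and lin: "\<And>t. t \<in> {0..T} \<Longrightarrow> linear (F t)"
    and cont: "\<And>v. continuous_on {0..T} (\<lambda>t. F t v)"
  shows "\<exists>x. x 0 = x0 \<and> (\<forall>t\<in>{0..T}. (x has_vector_derivative F t (x t)) (at t within {0..T}))"
proof -
  obtain L where L: "L > 0" "\<And>t v. t \<in> {0..T} \<Longrightarrow> norm (F t v) \<le> L * norm v"
    using linear_family_bound[of "{0..T}" F] lin cont by (metis compact_Icc)
  \<comment> \<open>\<open>u n\<close> is the \<open>n\<close>-th increment, so the solution is the
    sum of all \<open>u n\<close>, not their limit.\<close>
  define u where "u = rec_nat (\<lambda>t. x0) (\<lambda>n v t. integral {0..t} (\<lambda>s. F s (v s)))"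
  have u0: "u 0 = (\<lambda>t. x0)" and uS: "u (Suc n) = (\<lambda>t. integral {0..t} (\<lambda>s. F s (u n s)))" for n
    by (simp_all add: u_def)
  have Fc: "continuous_on {0..T} (\<lambda>t. F t (v t))" if "continuous_on {0..T} v" for v
    by (rule continuous_on_linear_family[OF lin cont that])
  have uc: "continuous_on {0..T} (u n)" for n
    by (induction n) (auto simp: u0 uS intro!: indefinite_integral_continuous_1 integrable_continuous_real Fc)
  have ub: "norm (u n t) \<le> norm x0 * (L * t) ^ n / fact n" if "t \<in> {0..T}" for n t
    using that
  proof (induction n arbitrary: t)
    case (Suc n)
    \<comment> \<open>\<open>?G\<close> is the bound claimed for \<open>Suc n\<close>; its
      derivative \<open>?g\<close> is \<open>L\<close> times the bound for \<open>n\<close>, so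
      integrating the induction hypothesis reproduces the bound.\<close>
    define c where "c = norm x0 * L ^ Suc n / fact (Suc n)"
    have c: "c * real (Suc n) = norm x0 * L ^ Suc n / fact n"
      by (simp add: c_def divide_simps del: of_nat_Suc power_Suc)
    let ?g = "\<lambda>s. c * real (Suc n) * s ^ n"
    let ?G = "\<lambda>s. c * s ^ Suc n"
    have G: "(?g has_integral (?G t - ?G 0)) {0..t}"
    proof (rule fundamental_theorem_of_calculus)
      show "(?G has_vector_derivative ?g s) (at s within {0..t})" for s
        using DERIV_cmult[OF DERIV_pow[of "Suc n" s "{0..t}"], of c]
        unfolding has_real_derivative_iff_has_vector_derivative[symmetric]
        by (simp del: power_Suc add: mult.assoc)
    qed (use Suc in auto)
    have "norm (u (Suc n) t) \<le> integral {0..t} ?g"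
      unfolding uS
    proof (rule integral_norm_bound_integral)
      show "(\<lambda>s. F s (u n s)) integrable_on {0..t}"
        by (rule integrable_continuous_real[OF continuous_on_subset[OF Fc[OF uc]]]) (use Suc in auto)
      show "?g integrable_on {0..t}" using G by blast
      fix s assume s: "s \<in> {0..t}"
      then have "norm (F s (u n s)) \<le> L * norm (u n s)" using Suc L by auto
      also have "\<dots> \<le> L * (norm x0 * (L * s) ^ n / fact n)"
        using Suc s L(1) by (intro mult_left_mono Suc.IH) auto
      finally show "norm (F s (u n s)) \<le> ?g s"
        by (simp add: c power_mult_distrib mult_ac del: of_nat_Suc)
    qed
    also have "\<dots> = ?G t" using integral_unique[OF G] by simp
    finally show ?case by (simp add: c_def power_mult_distrib mult_ac)
  qed (simp add: u0)
  \<comment> \<open>The derivative of \<open>u (Suc n)\<close> is \<open>F\<close> applied to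
    \<open>u n\<close>, and the constant \<open>u 0\<close> contributes 0. The same index shift
    appears in the majorant of the M-test and in the use of \<open>sums_Suc\<close>.\<close>
  define u' where "u' n t = (case n of 0 \<Rightarrow> 0 | Suc n \<Rightarrow> F t (u n t))" for n t
  have ud: "(u n has_vector_derivative u' n t) (at t within {0..T})" if "t \<in> {0..T}" for n t
  proof (cases n)
    case 0 then show ?thesis by (simp add: u'_def u0)
  next
    case (Suc k)
    then show ?thesis
      using integral_has_vector_derivative[OF Fc[OF uc[of k]] that] by (simp add: u'_def uS)
  qed
  have su: "summable (\<lambda>n. norm x0 * (L * T) ^ n / fact n)"
    using summable_mult[OF summable_exp_generic[of "L * T"], of "norm x0"]
    by (simp add: divide_inverse mult_ac)
  have ub': "norm (u n t) \<le> norm x0 * (L * T) ^ n / fact n" if t: "t \<in> {0..T}" for n t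
    by (rule order_trans[OF ub[OF t]])
      (use t L in \<open>auto intro!: divide_right_mono mult_left_mono power_mono\<close>)
  have "uniform_limit {0..T} (\<lambda>n t. \<Sum>i<n. u' i t) (\<lambda>t. \<Sum>i. u' i t) sequentially"
  proof (rule Weierstrass_m_test[where M="\<lambda>n. case n of 0 \<Rightarrow> 0 | Suc n \<Rightarrow> L * (norm x0 * (L * T) ^ n / fact n)"])
    show "summable (\<lambda>n. case n of 0 \<Rightarrow> 0 | Suc n \<Rightarrow> L * (norm x0 * (L * T) ^ n / fact n))"
      by (subst summable_Suc_iff[symmetric]) (use summable_mult[OF su, of L] in simp)
    show "norm (u' n t) \<le> (case n of 0 \<Rightarrow> 0 | Suc n \<Rightarrow> L * (norm x0 * (L * T) ^ n / fact n))"
      if "t \<in> {0..T}" for n t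
    proof (cases n)
      case (Suc k)
      have "norm (F t (u k t)) \<le> L * (norm x0 * (L * T) ^ k / fact k)"
        by (rule order_trans[OF L(2)[OF that] mult_left_mono[OF ub'[OF that]]]) (use L in simp)
      then show ?thesis by (simp add: u'_def Suc)
    qed (simp add: u'_def)
  qed
  then have ul: "\<forall>e>0. \<forall>\<^sub>F n in sequentially. \<forall>t\<in>{0..T}. norm ((\<Sum>i<n. u' i t) - (\<Sum>i. u' i t)) < e"
    unfolding uniform_limit_iff dist_norm .
  have "\<exists>g. \<forall>t\<in>{0..T}. (\<lambda>n. u n t) sums g t \<and> (g has_derivative (\<lambda>h. h *\<^sub>R (\<Sum>i. u' i t))) (at t within {0..T})"
  proof (rule has_derivative_series)
    show "(u n has_derivative (\<lambda>h. h *\<^sub>R u' n t)) (at t within {0..T})" if "t \<in> {0..T}" for n t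
      using ud[OF that] by (simp add: has_vector_derivative_def)
    show "\<forall>\<^sub>F n in sequentially. \<forall>t\<in>{0..T}. \<forall>h. norm ((\<Sum>i<n. h *\<^sub>R u' i t) - h *\<^sub>R (\<Sum>i. u' i t)) \<le> e * norm h"
      if "e > 0" for e
      using ul[rule_format, OF that]
    proof eventually_elim
      case (elim n)
      show ?case
      proof (intro ballI allI)
        fix t h assume "t \<in> {0..T}"
        then have "norm ((\<Sum>i<n. u' i t) - (\<Sum>i. u' i t)) \<le> e" using elim by force
        then show "norm ((\<Sum>i<n. h *\<^sub>R u' i t) - h *\<^sub>R (\<Sum>i. u' i t)) \<le> e * norm h"
          by (simp add: mult.commute[of e] mult_left_mono flip: scaleR_sum_right scaleR_diff_right)
      qed
    qed
    show "(\<lambda>n. u n 0) sums (\<Sum>n. u n 0)"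
      by (rule summable_sums, rule summable_comparison_test'[OF su, of 0]) (use ub'[of 0] T in auto)
  qed (use T in auto)
  then obtain g where g: "\<And>t. t \<in> {0..T} \<Longrightarrow> (\<lambda>n. u n t) sums g t"
    "\<And>t. t \<in> {0..T} \<Longrightarrow> (g has_vector_derivative (\<Sum>i. u' i t)) (at t within {0..T})"
    unfolding has_vector_derivative_def by blast
  have "g 0 = x0"
  proof -
    \<comment> \<open>At time 0 every increment except \<open>u 0\<close> is an integral over a
      degenerate interval.\<close>
    have "(\<lambda>n. u n 0) = (\<lambda>n. if n = 0 then x0 else 0)"
      by (rule ext) (use uS in \<open>auto simp: u0 gr0_conv_Suc\<close>)
    then show ?thesis using sums_unique2[OF g(1)[of 0], of x0] sums_single[of 0 "\<lambda>_. x0"] T by simp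
  qed
  moreover have "(\<Sum>i. u' i t) = F t (g t)" if t: "t \<in> {0..T}" for t
  proof -
    have "(\<lambda>n. F t (u n t)) sums F t (g t)"
      using bounded_linear.sums[OF _ g(1)[OF t]] lin[OF t] by (simp add: linear_conv_bounded_linear)
    then have "(\<lambda>n. u' (Suc n) t) sums F t (g t)" by (simp add: u'_def)
    then have "(\<lambda>n. u' n t) sums (F t (g t) + u' 0 t)" by (rule sums_Suc)
    then show ?thesis by (simp add: u'_def sums_iff)
  qed
  ultimately show ?thesis using g(2) by auto
qed

text \<open>Time reversal: passing to \<open>x (T - t)\<close> exchanges terminal and initial data
  and replaces \<open>F t\<close> by \<open>- F (T - t)\<close>.\<close>

lemma linear_ode_exists_terminal:
  fixes F :: "real \<Rightarrow> 'a::euclidean_space \<Rightarrow> 'a"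
  assumes T: "0 \<le> T"
    and lin: "\<And>t. t \<in> {0..T} \<Longrightarrow> linear (F t)"
    and cont: "\<And>v. continuous_on {0..T} (\<lambda>t. F t v)"
  shows "\<exists>x. x T = xT \<and> (\<forall>t\<in>{0..T}. (x has_vector_derivative F t (x t)) (at t within {0..T}))"
proof -
  have r: "(\<lambda>t. T - t) ` {0..T} = {0..T}"
    by (auto simp: image_iff intro!: bexI[of _ "T - _"])
  have "\<exists>x. x 0 = xT \<and> (\<forall>t\<in>{0..T}. (x has_vector_derivative - F (T - t) (x t)) (at t within {0..T}))"
  proof (rule linear_ode_exists[OF T])
    show "linear (\<lambda>v. - F (T - t) v)" if "t \<in> {0..T}" for t
      using lin[of "T - t"] that by (auto intro!: linear_compose_neg)
    show "continuous_on {0..T} (\<lambda>t. - F (T - t) v)" for v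
      by (intro continuous_intros continuous_on_compose2[OF cont[of v], of _ "\<lambda>t. T - t"])
        (auto intro!: continuous_intros)
  qed
  then obtain x where x: "x 0 = xT"
    "\<And>t. t \<in> {0..T} \<Longrightarrow> (x has_vector_derivative - F (T - t) (x t)) (at t within {0..T})" by blast
  have "((\<lambda>t. x (T - t)) has_vector_derivative F t (x (T - t))) (at t within {0..T})" if t: "t \<in> {0..T}" for t
  proof -
    have "((\<lambda>t. T - t) has_vector_derivative -1) (at t within {0..T})"
      by (auto intro!: derivative_eq_intros)
    from vector_diff_chain_within[OF this, of x, unfolded r, OF x(2)] t
    show ?thesis by (simp add: o_def)
  qed
  then show ?thesis using x(1) by (intro exI[of _ "\<lambda>t. x (T - t)"]) auto
qed

section \<open>A product rule for indefinite integrals\<close>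

text \<open>Replaces the theorem on vanishing derivatives when only increments are controlled: on a
  partition into \<open>n\<close> equal pieces shorter than \<open>d\<close> the bounds telescope to
  \<open>e * (G b - G a)\<close>, and \<open>e\<close> is arbitrary.\<close>

lemma equal_endpoints_of_small_increments:
  fixes \<Phi> :: "real \<Rightarrow> 'a::real_normed_vector" and G :: "real \<Rightarrow> real"
  assumes ab: "a \<le> b"
    and small: "\<And>e. e > 0 \<Longrightarrow> \<exists>d>0. \<forall>s t. a \<le> s \<and> s \<le> t \<and> t \<le> b \<and> t - s < d
      \<longrightarrow> norm (\<Phi> t - \<Phi> s) \<le> e * (G t - G s)"
  shows "\<Phi> b = \<Phi> a"
proof -
  have le: "norm (\<Phi> b - \<Phi> a) \<le> e * (G b - G a)" if e: "e > 0" for e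
  proof -
    obtain d where d: "d > 0" "\<And>s t. a \<le> s \<Longrightarrow> s \<le> t \<Longrightarrow> t \<le> b \<Longrightarrow> t - s < d
        \<Longrightarrow> norm (\<Phi> t - \<Phi> s) \<le> e * (G t - G s)"
      using small[OF e] by blast
    \<comment> \<open>The maximum with 1 keeps \<open>n\<close> positive also when
      \<open>a = b\<close>.\<close>
    obtain n where n: "n > 0" "(b - a) / d < real n"
      using reals_Archimedean2[of "max 1 ((b - a) / d)"]
      by (metis max_less_iff_conj of_nat_0_less_iff order_less_trans zero_less_one)
    define p where "p i = a + real i * ((b - a) / real n)" for i
    have "norm (\<Phi> (p k) - \<Phi> a) \<le> e * (G (p k) - G a)" if "k \<le> n" for k
      using that
    proof (induction k)
      case (Suc k)
      have "p (Suc k) - p k = (b - a) / real n" by (simp add: p_def distrib_right add_divide_distrib)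
      moreover have "(b - a) / real n < d" using n d(1) by (simp add: field_simps)
      moreover have "a \<le> p k" "p k \<le> p (Suc k)"
        using ab by (simp_all add: p_def divide_right_mono mult_right_mono)
      moreover have "real (Suc k) * (b - a) \<le> real n * (b - a)"
        using Suc.prems ab by (intro mult_right_mono) auto
      then have "p (Suc k) \<le> b" using n by (simp add: p_def field_simps)
      ultimately have "norm (\<Phi> (p (Suc k)) - \<Phi> (p k)) \<le> e * (G (p (Suc k)) - G (p k))"
        by (intro d(2)) auto
      then show ?case
        using Suc norm_triangle_ineq[of "\<Phi> (p (Suc k)) - \<Phi> (p k)" "\<Phi> (p k) - \<Phi> a"]
        by (simp add: algebra_simps)
    qed (simp add: p_def)
    from this[of n] n show ?thesis by (simp add: p_def)
  qed
  \<comment> \<open>The case \<open>e = 1\<close> shows that \<open>G\<close> does not decrease from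
    \<open>a\<close> to \<open>b\<close>. Below, the added 1 keeps the denominator positive when the
    two values agree.\<close>
  have C: "0 \<le> G b - G a" using le[of 1] by (smt (verit) norm_ge_zero)
  have "norm (\<Phi> b - \<Phi> a) \<le> 0 + e" if "e > 0" for e
  proof -
    have "norm (\<Phi> b - \<Phi> a) \<le> e / (G b - G a + 1) * (G b - G a)"
      using that C by (intro le) auto
    also have "\<dots> \<le> e" using that C by (simp add: field_simps)
    finally show ?thesis by simp
  qed
  then have "norm (\<Phi> b - \<Phi> a) \<le> 0" by (rule field_le_epsilon)
  then show ?thesis by simp
qed

lemma bounded_bilinear_absolutely_integrable:
  fixes f :: "real \<Rightarrow> 'a::euclidean_space" and g :: "real \<Rightarrow> 'b::euclidean_space"
    and h :: "'a \<Rightarrow> 'b \<Rightarrow> 'c::euclidean_space"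
  assumes "bounded_bilinear h" "continuous_on {a..b} f" "g absolutely_integrable_on {a..b}"
  shows "(\<lambda>t. h (f t) (g t)) absolutely_integrable_on {a..b}"
  by (rule absolutely_integrable_bounded_measurable_product)
    (use assms in \<open>auto simp: bilinear_conv_bounded_bilinear intro!: compact_imp_bounded
      compact_continuous_image continuous_imp_measurable_on_sets_lebesgue\<close>)

text \<open>Lebesgue differentiation is avoided: over a short interval the two sides differ by at most
  the oscillation of the factors times the variation of the primitives.\<close>

lemma indefinite_integral_product_rule:
  fixes f :: "real \<Rightarrow> 'a::euclidean_space" and g :: "real \<Rightarrow> 'b::euclidean_space"
    and h :: "'a \<Rightarrow> 'b \<Rightarrow> 'c::euclidean_space"
  assumes h: "bounded_bilinear h" and ab: "a \<le> b"
    and f: "f absolutely_integrable_on {a..b}" and g: "g absolutely_integrable_on {a..b}"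
    and F: "\<And>t. t \<in> {a..b} \<Longrightarrow> F t = F0 + integral {a..t} f"
    and G: "\<And>t. t \<in> {a..b} \<Longrightarrow> G t = G0 + integral {a..t} g"
  shows "(\<lambda>t. h (F t) (g t) + h (f t) (G t)) absolutely_integrable_on {a..b}" (is "?\<phi> absolutely_integrable_on _")
    and "h (F b) (G b) = h (F a) (G a) + integral {a..b} (\<lambda>t. h (F t) (g t) + h (f t) (G t))"
proof -
  interpret bounded_bilinear h by fact
  have fi: "f integrable_on {a..b}" and gi: "g integrable_on {a..b}"
    using f g by (auto simp: absolutely_integrable_on_def)
  have Fc: "continuous_on {a..b} F"
    by (rule continuous_on_eq[where f="\<lambda>t. F0 + integral {a..t} f"])
      (auto intro!: continuous_intros indefinite_integral_continuous_1 fi simp: F)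
  have Gc: "continuous_on {a..b} G"
    by (rule continuous_on_eq[where f="\<lambda>t. G0 + integral {a..t} g"])
      (auto intro!: continuous_intros indefinite_integral_continuous_1 gi simp: G)
  show ai: "?\<phi> absolutely_integrable_on {a..b}"
    by (intro set_integral_add(1) bounded_bilinear_absolutely_integrable[OF h Fc g]
        bounded_bilinear_absolutely_integrable[OF flip Gc f])
  then have \<phi>i: "?\<phi> integrable_on {a..b}" by (simp add: absolutely_integrable_on_def)
  define n where "n t = norm (f t) + norm (g t)" for t
  have ni: "n integrable_on {a..b}"
    unfolding n_def by (intro integrable_add) (use f g in \<open>auto simp: absolutely_integrable_on_def\<close>)
  obtain K where K: "K > 0" "\<And>x y. norm (h x y) \<le> norm x * norm y * K"
    using pos_bounded by blast
  \<comment> \<open>The defect of the product rule on \<open>{a..t}\<close>; equal values at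
    \<open>a\<close> and \<open>b\<close> are exactly the claim.\<close>
  define \<Phi> where "\<Phi> t = h (F t) (G t) - integral {a..t} ?\<phi>" for t
  have "\<Phi> b = \<Phi> a"
  proof (rule equal_endpoints_of_small_increments[OF ab, where G="\<lambda>t. integral {a..t} n"])
    fix e :: real assume e: "e > 0"
    define \<eta> where "\<eta> = e / K"
    have \<eta>: "\<eta> > 0" using e K by (simp add: \<eta>_def)
    have uc: "uniformly_continuous_on {a..b} F" "uniformly_continuous_on {a..b} G"
      using compact_uniformly_continuous Fc Gc by blast+
    obtain d1 where d1: "d1 > 0" "\<And>s t. s \<in> {a..b} \<Longrightarrow> t \<in> {a..b} \<Longrightarrow> dist s t < d1 \<Longrightarrow> dist (F s) (F t) < \<eta>"
      using uc(1) \<eta> unfolding uniformly_continuous_on_def by metis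
    obtain d2 where d2: "d2 > 0" "\<And>s t. s \<in> {a..b} \<Longrightarrow> t \<in> {a..b} \<Longrightarrow> dist s t < d2 \<Longrightarrow> dist (G s) (G t) < \<eta>"
      using uc(2) \<eta> unfolding uniformly_continuous_on_def by metis
    show "\<exists>d>0. \<forall>s t. a \<le> s \<and> s \<le> t \<and> t \<le> b \<and> t - s < d
      \<longrightarrow> norm (\<Phi> t - \<Phi> s) \<le> e * (integral {a..t} n - integral {a..s} n)"
    proof (intro exI[of _ "min d1 d2"] conjI allI impI; (elim conjE)?)
      fix s t assume st: "a \<le> s" "s \<le> t" "t \<le> b" "t - s < min d1 d2"
      have split: "integral {a..t} u - integral {a..s} u = integral {s..t} u"
        if "u integrable_on {a..b}" for u :: "real \<Rightarrow> 'z::banach"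
        using Henstock_Kurzweil_Integration.integral_combine[OF st(1,2) integrable_on_subinterval[OF that]] st
        by (simp add: algebra_simps)
      have sub: "u integrable_on {s..t}" if "u integrable_on {a..b}" for u :: "real \<Rightarrow> 'z::banach"
        by (rule integrable_on_subinterval[OF that]) (use st in auto)
      have FF: "F t - F s = integral {s..t} f" and GG: "G t - G s = integral {s..t} g"
        using F[of t] F[of s] G[of t] G[of s] split[OF fi] split[OF gi] st by auto
      \<comment> \<open>\<open>i1\<close> and \<open>i2\<close> split the increment of the product
        as \<open>h (F t - F s) (G t) + h (F s) (G t - G s)\<close>; subtracting \<open>i3\<close>
        leaves only oscillations of \<open>F\<close> and \<open>G\<close> paired with
        \<open>f\<close> and \<open>g\<close>.\<close>
      have i1: "((\<lambda>r. h (f r) (G t)) has_integral h (F t - F s) (G t)) {s..t}"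
        unfolding FF using has_integral_linear[OF integrable_integral[OF sub[OF fi]] bounded_linear_left[of "G t"]]
        by (simp add: o_def)
      have i2: "((\<lambda>r. h (F s) (g r)) has_integral h (F s) (G t - G s)) {s..t}"
        unfolding GG using has_integral_linear[OF integrable_integral[OF sub[OF gi]] bounded_linear_right[of "F s"]]
        by (simp add: o_def)
      have i3: "(?\<phi> has_integral integral {a..t} ?\<phi> - integral {a..s} ?\<phi>) {s..t}"
        unfolding split[OF \<phi>i] by (rule integrable_integral[OF sub[OF \<phi>i]])
      have i4: "((\<lambda>r. h (f r) (G t - G r) + h (F s - F r) (g r)) has_integral \<Phi> t - \<Phi> s) {s..t}"
        using has_integral_diff[OF has_integral_add[OF i1 i2] i3]
        by (simp add: \<Phi>_def diff_left diff_right algebra_simps)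
      have i5: "((\<lambda>r. e * n r) has_integral e * (integral {a..t} n - integral {a..s} n)) {s..t}"
        unfolding split[OF ni] by (intro has_integral_mult_right integrable_integral sub ni)
      have "norm (h (f r) (G t - G r) + h (F s - F r) (g r)) \<le> e * n r" if r: "r \<in> {s..t}" for r
      proof -
        have "norm (G t - G r) \<le> \<eta>" "norm (F s - F r) \<le> \<eta>"
          using d1(2)[of s r] d2(2)[of t r] st r by (auto simp: dist_norm intro!: less_imp_le)
        then have "norm (h (f r) (G t - G r)) \<le> norm (f r) * \<eta> * K"
          "norm (h (F s - F r) (g r)) \<le> \<eta> * norm (g r) * K"
          using K by (auto intro!: order_trans[OF K(2)] mult_right_mono mult_left_mono)
        then have "norm (h (f r) (G t - G r) + h (F s - F r) (g r)) \<le> \<eta> * K * n r"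
          using norm_triangle_ineq[of "h (f r) (G t - G r)" "h (F s - F r) (g r)"]
          by (simp add: n_def algebra_simps)
        then show ?thesis using K by (simp add: \<eta>_def)
      qed
      then show "norm (\<Phi> t - \<Phi> s) \<le> e * (integral {a..t} n - integral {a..s} n)"
        using integral_norm_bound_integral[OF has_integral_integrable[OF i4] has_integral_integrable[OF i5]]
          integral_unique[OF i4] integral_unique[OF i5] by (simp only:)
    qed (use d1 d2 in auto)
  qed
  then show "h (F b) (G b) = h (F a) (G a) + integral {a..b} ?\<phi>"
    by (simp add: \<Phi>_def algebra_simps)
qed

section \<open>The linear matrix inequality\<close>

text \<open>For symmetric \<open>P\<close> this is the derivative of
  \<open>x \<bullet> (P *v x)\<close> along the controlled system plus the running cost. It is also
  the quadratic form of the LMI matrix, so the LMI says that it is negative.\<close>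

definition dissipation :: "real^('s::finite)^'s \<Rightarrow> real^('w::finite)^'s \<Rightarrow> real^('s+'w)^('s+'w)
    \<Rightarrow> real^'s^'s \<Rightarrow> real^'s^'s \<Rightarrow> real^'s \<Rightarrow> real^'w \<Rightarrow> real" where
  "dissipation A B W P P' x w
    = x \<bullet> (P' *v x) + 2 * ((A *v x + B *v w) \<bullet> (P *v x)) + stack x w \<bullet> (W *v stack x w)"

lemma lmi_block_form:
  assumes "transpose P = P"
  shows "stack x w \<bullet> ((blk (P' + transpose A ** P + P ** A) (P ** B) (transpose B ** P) 0 + W) *v stack x w)
    = dissipation A B W P P' x w"
proof -
  have "x \<bullet> ((transpose A ** P) *v x) = (A *v x) \<bullet> (P *v x)"
    "w \<bullet> ((transpose B ** P) *v x) = (B *v w) \<bullet> (P *v x)"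
    by (simp_all add: inner_matrix_vector_transpose flip: matrix_vector_mul_assoc)
  moreover have "x \<bullet> ((P ** A) *v x) = (A *v x) \<bullet> (P *v x)"
    "x \<bullet> ((P ** B) *v w) = (B *v w) \<bullet> (P *v x)"
    unfolding matrix_vector_mul_assoc[symmetric] symmetric_inner[OF assms, of x] by (rule inner_commute)+
  ultimately show ?thesis
    by (simp add: dissipation_def matrix_vector_mult_add_rdistrib blk_mult_stack inner_stack
        inner_add_right inner_add_left algebra_simps)
qed

lemma neg_def_lmi_block_iff:
  assumes "transpose P = P"
  shows "neg_def (blk (P' + transpose A ** P + P ** A) (P ** B) (transpose B ** P) 0 + W)
    \<longleftrightarrow> (\<forall>x w. x \<noteq> 0 \<or> w \<noteq> 0 \<longrightarrow> dissipation A B W P P' x w < 0)"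
  unfolding neg_def_def
  by (metis lmi_block_form[OF assms] stack_eq_0 stack_exhaust)

lemma lmi_feasible_iff:
  "lmi_feasible T A B W P \<longleftrightarrow>
    (\<exists>P'. (\<forall>t\<in>{0..T}. (P has_vector_derivative P' t) (at t within {0..T}))
      \<and> (\<forall>t\<in>{0..T}. transpose (P t) = P t) \<and> psd (P T)
      \<and> (\<forall>t\<in>{0..T}. \<forall>x w. x \<noteq> 0 \<or> w \<noteq> 0 \<longrightarrow> dissipation (A t) (B t) (W t) (P t) (P' t) x w < 0))"
  unfolding lmi_feasible_def by (intro ex_cong1) (auto simp: neg_def_lmi_block_iff)

lemma has_vector_derivative_quadratic_form:
  fixes P :: "real \<Rightarrow> real^'n::finite^'n"
  assumes x: "(x has_vector_derivative x') (at t within S)"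
    and P: "(P has_vector_derivative P') (at t within S)" and sym: "transpose (P t) = P t"
  shows "((\<lambda>t. x t \<bullet> (P t *v x t)) has_vector_derivative x t \<bullet> (P' *v x t) + 2 * (x' \<bullet> (P t *v x t)))
    (at t within S)"
  using bounded_bilinear.has_vector_derivative[OF bounded_bilinear_inner x
      bounded_bilinear.has_vector_derivative[OF bounded_bilinear_matrix_vector_mult P x]]
  by (rule has_vector_derivative_eq_rhs)
    (use symmetric_inner[OF sym, of "x t" x'] in \<open>simp add: inner_add_right inner_commute\<close>)

text \<open>Weak duality: \<open>V\<close> adds the cost accumulated so far to the storage term
  \<open>x \<bullet> P x\<close>, the LMI makes it nonincreasing, and \<open>psd (P T)\<close> lets
  the terminal term be dropped. The lemma stands outside \<open>lq_problem\<close> because the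
  subgradient inequality applies it at multipliers whose \<open>blk22\<close> has no assumed
  sign.\<close>

lemma cost_le_of_lmi_feasible:
  assumes T: "0 \<le> T" and W: "continuous_on {0..T} W" and P: "lmi_feasible T A B W P"
    and x: "\<And>t. t \<in> {0..T} \<Longrightarrow> (x has_vector_derivative A t *v x t + B t *v w t) (at t within {0..T})"
    and w: "continuous_on {0..T} w"
  shows "lq_cost T W x w \<le> x 0 \<bullet> (P 0 *v x 0)"
proof -
  obtain P' where P: "\<And>t. t \<in> {0..T} \<Longrightarrow> (P has_vector_derivative P' t) (at t within {0..T})"
    "\<And>t. t \<in> {0..T} \<Longrightarrow> transpose (P t) = P t" "psd (P T)"
    "\<And>t x w. t \<in> {0..T} \<Longrightarrow> x \<noteq> 0 \<or> w \<noteq> 0 \<Longrightarrow> dissipation (A t) (B t) (W t) (P t) (P' t) x w < 0"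
    using P unfolding lmi_feasible_iff by metis
  let ?c = "\<lambda>t. stack (x t) (w t) \<bullet> (W t *v stack (x t) (w t))"
  have xc: "continuous_on {0..T} x" by (rule has_vector_derivative_imp_continuous_on[OF x])
  have cc: "continuous_on {0..T} ?c"
    by (intro continuous_intros continuous_on_matrix_intros continuous_on_stack xc w W)
  define V where "V t = x t \<bullet> (P t *v x t) + integral {0..t} ?c" for t
  have "V T \<le> V 0"
  proof (rule antimono_from_vector_derivative[where f=V and a=0 and b=T])
    fix t assume t: "t \<in> {0..T}"
    have "(V has_vector_derivative x t \<bullet> (P' t *v x t)
        + 2 * ((A t *v x t + B t *v w t) \<bullet> (P t *v x t)) + ?c t) (at t within {0..T})"
      unfolding V_def
      by (intro has_vector_derivative_add has_vector_derivative_quadratic_form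
          integral_has_vector_derivative[OF cc t] x P t)
    then show "(V has_vector_derivative dissipation (A t) (B t) (W t) (P t) (P' t) (x t) (w t)) (at t within {0..T})"
      by (simp add: dissipation_def)
    show "dissipation (A t) (B t) (W t) (P t) (P' t) (x t) (w t) \<le> 0"
      using P(4)[OF t, of "x t" "w t"] by (cases "x t = 0 \<and> w t = 0") (auto simp: dissipation_def iffD2[OF stack_eq_0])
  qed (use T in auto)
  moreover have "0 \<le> x T \<bullet> (P T *v x T)" using P(3) by (simp add: psd_def)
  ultimately show ?thesis by (simp add: V_def lq_cost_def)
qed

lemma lq_traj_of_derivative:
  assumes A: "continuous_on {0..T} A" and B: "continuous_on {0..T} B"
    and x: "\<And>t. t \<in> {0..T} \<Longrightarrow> (x has_vector_derivative A t *v x t + B t *v w t) (at t within {0..T})"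
    and w: "continuous_on {0..T} w"
  shows "lq_traj T A B (x 0) x w"
  unfolding lq_traj_def
proof (intro conjI ballI)
  have xc: "continuous_on {0..T} x" by (rule has_vector_derivative_imp_continuous_on[OF x])
  show "w measurable_on {0..T}"
    using continuous_imp_measurable_on_sets_lebesgue[OF w] by (simp add: measurable_on_iff_borel_measurable)
  show "(\<lambda>t. (norm (w t))\<^sup>2) integrable_on {0..T}"
    by (intro integrable_continuous_real continuous_intros w)
  show "(\<lambda>s. A s *v x s + B s *v w s) integrable_on {0..T}"
    by (intro integrable_continuous_real continuous_intros continuous_on_matrix_intros w xc A B)
  fix t assume t: "t \<in> {0..T}"
  have "((\<lambda>s. A s *v x s + B s *v w s) has_integral x t - x 0) {0..t}"
  proof (rule fundamental_theorem_of_calculus)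
    fix s assume s: "s \<in> {0..t}"
    show "(x has_vector_derivative A s *v x s + B s *v w s) (at s within {0..t})"
      by (rule has_vector_derivative_within_subset[OF x]) (use s t in auto)
  qed (use t in auto)
  then show "x t = x 0 + integral {0..t} (\<lambda>s. A s *v x s + B s *v w s)"
    by (simp add: integral_unique)
qed

section \<open>The Hamiltonian flow and the Riccati equation\<close>

locale lq_problem =
  fixes T :: real and A :: "real \<Rightarrow> real^('s::finite)^'s" and B :: "real \<Rightarrow> real^('w::finite)^'s"
    and W :: "real \<Rightarrow> real^('s+'w)^('s+'w)"
  assumes T_pos: "0 < T"
    and A_cont: "continuous_on {0..T} A" and B_cont: "continuous_on {0..T} B"
    and W_cont: "continuous_on {0..T} W"
    and W_sym: "\<And>t. t \<in> {0..T} \<Longrightarrow> transpose (W t) = W t"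
    and R_neg: "\<And>t. t \<in> {0..T} \<Longrightarrow> neg_def (blk22 (W t))"
begin

abbreviation Q where "Q t \<equiv> blk11 (W t)"
abbreviation S where "S t \<equiv> blk12 (W t)"
abbreviation R where "R t \<equiv> blk22 (W t)"

lemma R_mult_inv:
  assumes "t \<in> {0..T}" shows "R t *v (matrix_inv (R t) *v v) = v"
  by (simp add: matrix_vector_mul_assoc matrix_inv_right_mult neg_def_invertible[OF R_neg[OF assms]])

lemma R_inv_cont: "continuous_on {0..T} (\<lambda>t. matrix_inv (R t))"
  by (intro continuous_on_matrix_inv continuous_on_matrix_intros W_cont neg_def_invertible R_neg)

lemmas W_blk_sym = symmetric_blk[OF W_sym]

text \<open>State, costate and control of the Hamiltonian system, in matrix form. \<open>U\<close>
  solves the stationarity condition R U = - (B^T L + S^T X), and the terminal values encode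
  \<open>Y T = 0\<close> for \<open>Y\<close> = L X^-1.\<close>

definition hamiltonian_flow where
  "hamiltonian_flow X L U \<longleftrightarrow> X T = mat 1 \<and> L T = 0 \<and> (\<forall>t\<in>{0..T}.
      U t = - matrix_inv (R t) ** (transpose (B t) ** L t + transpose (S t) ** X t)
    \<and> (X has_vector_derivative A t ** X t + B t ** U t) (at t within {0..T})
    \<and> (L has_vector_derivative - (transpose (A t) ** L t + Q t ** X t + S t ** U t)) (at t within {0..T}))"

text \<open>Substituting the stationarity condition for the control leaves a linear system in the
  pair of \<open>X\<close> and \<open>L\<close>, solved backwards from \<open>T\<close>.\<close>

lemma hamiltonian_flow_exists: "\<exists>X L U. hamiltonian_flow X L U"
proof -
  note mm = bounded_bilinear_matrix_matrix_mult
  note lin = bounded_bilinear.add_right[OF mm] bounded_bilinear.scaleR_right[OF mm]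
    bounded_bilinear.minus_right[OF mm] bounded_bilinear.diff_right[OF mm]
    scaleR_right_distrib scaleR_right_diff_distrib
  define u where "u t p = - matrix_inv (R t) ** (transpose (B t) ** snd p + transpose (S t) ** fst p)"
    for t and p :: "(real^'s^'s) \<times> (real^'s^'s)"
  define F where "F t p = (A t ** fst p + B t ** u t p, - (transpose (A t) ** snd p + Q t ** fst p + S t ** u t p))"
    for t p
  have "\<exists>z. z T = (mat 1, 0) \<and> (\<forall>t\<in>{0..T}. (z has_vector_derivative F t (z t)) (at t within {0..T}))"
  proof (rule linear_ode_exists_terminal)
    show "linear (F t)" for t
      by (rule linearI) (simp_all add: F_def u_def lin algebra_simps)
    show "continuous_on {0..T} (\<lambda>t. F t p)" for p
      unfolding F_def u_def
      by (intro continuous_intros continuous_on_matrix_intros R_inv_cont A_cont B_cont W_cont)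
  qed (use T_pos in simp)
  then obtain z where z: "z T = (mat 1, 0)"
    "\<And>t. t \<in> {0..T} \<Longrightarrow> (z has_vector_derivative F t (z t)) (at t within {0..T})" by blast
  have "hamiltonian_flow (\<lambda>t. fst (z t)) (\<lambda>t. snd (z t)) (\<lambda>t. u t (z t))"
    unfolding hamiltonian_flow_def
  proof (intro conjI ballI)
    fix t assume t: "t \<in> {0..T}"
    show "((\<lambda>t. fst (z t)) has_vector_derivative A t ** fst (z t) + B t ** u t (z t)) (at t within {0..T})"
      using bounded_linear.has_vector_derivative[OF bounded_linear_fst z(2)[OF t]] by (simp add: F_def)
    show "((\<lambda>t. snd (z t)) has_vector_derivative
        - (transpose (A t) ** snd (z t) + Q t ** fst (z t) + S t ** u t (z t))) (at t within {0..T})"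
      using bounded_linear.has_vector_derivative[OF bounded_linear_snd z(2)[OF t]] by (simp add: F_def)
  qed (simp_all add: z u_def)
  then show ?thesis by blast
qed

lemma hamiltonian_flow_vector:
  assumes H: "hamiltonian_flow X L U" and t: "t \<in> {0..T}"
  shows "((\<lambda>t. X t *v v) has_vector_derivative A t *v (X t *v v) + B t *v (U t *v v)) (at t within {0..T})"
    and "((\<lambda>t. L t *v v) has_vector_derivative
      - (transpose (A t) *v (L t *v v) + Q t *v (X t *v v) + S t *v (U t *v v))) (at t within {0..T})"
    and "U t *v v = - (matrix_inv (R t) *v (transpose (B t) *v (L t *v v) + transpose (S t) *v (X t *v v)))"
    and "R t *v (U t *v v) = - (transpose (B t) *v (L t *v v) + transpose (S t) *v (X t *v v))"
proof -
  note mv = bounded_bilinear_matrix_vector_mult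
  note mvd = bounded_linear.has_vector_derivative[OF bounded_bilinear.bounded_linear_left[OF mv]]
  have neg: "(- N) *v y = - (N *v y)" for N :: "real^'a::finite^'b::finite" and y
    by (rule bounded_bilinear.minus_left[OF mv])
  have XL: "(X has_vector_derivative A t ** X t + B t ** U t) (at t within {0..T})"
    "(L has_vector_derivative - (transpose (A t) ** L t + Q t ** X t + S t ** U t)) (at t within {0..T})"
    and U: "U t = - matrix_inv (R t) ** (transpose (B t) ** L t + transpose (S t) ** X t)"
    using H t unfolding hamiltonian_flow_def by blast+
  show "((\<lambda>t. X t *v v) has_vector_derivative A t *v (X t *v v) + B t *v (U t *v v)) (at t within {0..T})"
    using mvd[OF XL(1), of v] by (simp add: matrix_vector_mult_add_rdistrib matrix_vector_mul_assoc)
  show "((\<lambda>t. L t *v v) has_vector_derivative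
      - (transpose (A t) *v (L t *v v) + Q t *v (X t *v v) + S t *v (U t *v v))) (at t within {0..T})"
    using mvd[OF XL(2), of v]
    by (simp only: neg matrix_vector_mult_add_rdistrib matrix_vector_mul_assoc)
  show w: "U t *v v = - (matrix_inv (R t) *v (transpose (B t) *v (L t *v v) + transpose (S t) *v (X t *v v)))"
    unfolding U matrix_vector_mul_assoc[symmetric] neg
    by (simp only: matrix_vector_mult_add_rdistrib matrix_vector_mul_assoc)
  show "R t *v (U t *v v) = - (transpose (B t) *v (L t *v v) + transpose (S t) *v (X t *v v))"
    unfolding w bounded_bilinear.minus_right[OF mv] R_mult_inv[OF t] ..
qed

text \<open>The left-hand side is the derivative of \<open>x \<bullet> l\<close> along the flow;
  stationarity of the control makes it minus the running cost.\<close>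

lemma hamiltonian_form:
  assumes t: "t \<in> {0..T}"
    and Rw: "R t *v w = - (transpose (B t) *v l + transpose (S t) *v x)"
  shows "(A t *v x + B t *v w) \<bullet> l + x \<bullet> - (transpose (A t) *v l + Q t *v x + S t *v w)
    = - (stack x w \<bullet> (W t *v stack x w))"
proof -
  have "w \<bullet> (R t *v w) = - (B t *v w) \<bullet> l - (S t *v w) \<bullet> x"
    unfolding Rw by (simp add: inner_diff_right inner_matrix_vector_transpose)
  then show ?thesis
    by (simp add: symmetric_stack_form[OF W_sym[OF t]] inner_add_right inner_diff_right inner_add_left
        inner_matrix_vector_transpose[of _ "transpose (A t)"] inner_commute)
qed

lemma hamiltonian_state_invertible:
  assumes P: "lmi_feasible T A B W P" and H: "hamiltonian_flow X L U" and t0: "t0 \<in> {0..T}"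
  shows "invertible (X t0)"
proof -
  obtain P' where P: "\<And>t. t \<in> {0..T} \<Longrightarrow> (P has_vector_derivative P' t) (at t within {0..T})"
    "\<And>t. t \<in> {0..T} \<Longrightarrow> transpose (P t) = P t" "psd (P T)"
    "\<And>t x w. t \<in> {0..T} \<Longrightarrow> x \<noteq> 0 \<or> w \<noteq> 0 \<Longrightarrow> dissipation (A t) (B t) (W t) (P t) (P' t) x w < 0"
    using P unfolding lmi_feasible_iff by metis
  have "\<xi> = 0" if \<xi>: "X t0 *v \<xi> = 0" for \<xi>
  proof (rule ccontr)
    assume nz: "\<xi> \<noteq> 0"
    define x l w where "x t = X t *v \<xi>" and "l t = L t *v \<xi>" and "w t = U t *v \<xi>" for t
    \<comment> \<open>Wherever \<open>X\<close> is invertible, \<open>x \<bullet> l\<close> is the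
      quadratic form of L X^-1 at \<open>x\<close>, yet writing it needs no inverse. By
      \<open>hamiltonian_form\<close> the derivative of \<open>V\<close> is the dissipation.\<close>
    define V where "V t = x t \<bullet> (P t *v x t) - x t \<bullet> l t" for t
    have V: "(V has_vector_derivative dissipation (A t) (B t) (W t) (P t) (P' t) (x t) (w t)) (at t within {0..T})"
      if t: "t \<in> {0..T}" for t
    proof -
      note h = hamiltonian_flow_vector[OF H t, of \<xi>, folded x_def l_def w_def]
      note form = hamiltonian_form[OF t h(4)]
      show ?thesis unfolding V_def
        by (rule has_vector_derivative_eq_rhs[OF has_vector_derivative_diff[OF
              has_vector_derivative_quadratic_form[OF h(1) P(1)[OF t] P(2)[OF t]]
              bounded_bilinear.has_vector_derivative[OF bounded_bilinear_inner h(1,2)]]])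
          (use form in \<open>simp add: dissipation_def\<close>)
    qed
    have "dissipation (A t) (B t) (W t) (P t) (P' t) (x t) (w t) \<le> 0" if "t \<in> {0..T}" for t
      using P(4)[OF that, of "x t" "w t"]
      by (cases "x t = 0 \<and> w t = 0") (auto simp: dissipation_def iffD2[OF stack_eq_0])
    note anti = antimono_from_vector_derivative[OF V this]
    have XT: "X T = mat 1" and LT: "L T = 0" using H by (auto simp: hamiltonian_flow_def)
    have xT: "x T = \<xi>" by (simp add: x_def XT)
    have "V t0 = 0" using \<xi> by (simp add: V_def x_def)
    moreover have VT: "0 \<le> V T" using P(3) by (simp add: V_def l_def LT psd_def)
    ultimately have V0: "V t = 0" if "t \<in> {t0..T}" for t
      using anti[of t0 t] anti[of t T] that t0 by auto
    have "t0 \<noteq> T" using \<xi> nz XT by auto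
    then have "t0 < T" using t0 by auto
    \<comment> \<open>The one-sided derivative of \<open>V\<close> at \<open>T\<close> within the
      nondegenerate interval is computed twice: as the dissipation, negative because
      \<open>x T = \<xi>\<close> is nonzero, and as 0, because \<open>V\<close> vanishes
      there.\<close>
    moreover have "(V has_vector_derivative dissipation (A T) (B T) (W T) (P T) (P' T) (x T) (w T)) (at T within cbox t0 T)"
      using T_pos t0 by (intro has_vector_derivative_within_subset[OF V]) auto
    moreover have "(V has_vector_derivative 0) (at T within cbox t0 T)"
      by (rule has_vector_derivative_transform[OF _ _ has_vector_derivative_const[of 0]])
        (use V0 \<open>t0 < T\<close> in auto)
    ultimately have "dissipation (A T) (B T) (W T) (P T) (P' T) (x T) (w T) = 0"
      using vector_derivative_unique_within_closed_interval[of t0 T T] by auto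
    then show False using P(4)[of T "x T" "w T"] xT nz T_pos by auto
  qed
  then show ?thesis by (metis invertible_left_inverse matrix_left_invertible_ker)
qed

section \<open>Existence and symmetry of Riccati solutions\<close>

abbreviation gain where "gain Y t \<equiv> matrix_inv (R t) ** transpose (Y t ** B t + S t)"

lemma riccati_sol_exists:
  assumes P: "lmi_feasible T A B W P"
  shows "\<exists>Y. riccati_sol T A B W Y"
proof -
  obtain X L U where H: "hamiltonian_flow X L U" using hamiltonian_flow_exists by blast
  then have LT: "L T = 0"
    and X: "\<And>t. t \<in> {0..T} \<Longrightarrow> (X has_vector_derivative A t ** X t + B t ** U t) (at t within {0..T})"
    and L: "\<And>t. t \<in> {0..T} \<Longrightarrow> (L has_vector_derivative
        - (transpose (A t) ** L t + Q t ** X t + S t ** U t)) (at t within {0..T})"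
    unfolding hamiltonian_flow_def by blast+
  note inv = hamiltonian_state_invertible[OF P H]
  define Y where "Y t = L t ** matrix_inv (X t)" for t
  note mm = bounded_bilinear_matrix_matrix_mult and mv = bounded_bilinear_matrix_vector_mult
  have Xv: "X t *v (matrix_inv (X t) *v v) = v" if "t \<in> {0..T}" for t v
    by (simp add: matrix_vector_mul_assoc matrix_inv_right_mult inv[OF that])
  \<comment> \<open>The symplectic form of two solutions of the flow is conserved, and it vanishes
    at \<open>T\<close> because \<open>L T = 0\<close>; hence X^T L and \<open>Y\<close> are
    symmetric. This must precede the Riccati equation, whose gain contains the transpose of
    \<open>Y t ** B t\<close> while the flow yields \<open>transpose (B t) ** Y t\<close>.\<close>
  have sym: "(X t *v v) \<bullet> (L t *v u) = (L t *v v) \<bullet> (X t *v u)" if t: "t \<in> {0..T}" for t u v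
  proof -
    define D where "D t = (X t *v v) \<bullet> (L t *v u) - (L t *v v) \<bullet> (X t *v u)" for t
    have "(D has_vector_derivative 0) (at t within {0..T})" if t: "t \<in> {0..T}" for t
    proof -
      note h = hamiltonian_flow_vector[OF H t]
      have *: "(B t *v (U t *v v)) \<bullet> (L t *v u)
          = - ((U t *v v) \<bullet> (R t *v (U t *v u))) - (S t *v (U t *v v)) \<bullet> (X t *v u)" for v u
        unfolding h(4)
        by (simp add: inner_diff_right inner_matrix_vector_transpose[of "U t *v v"])
      have "(U t *v v) \<bullet> (R t *v (U t *v u)) = (U t *v u) \<bullet> (R t *v (U t *v v))"
        "(X t *v v) \<bullet> (Q t *v (X t *v u)) = (X t *v u) \<bullet> (Q t *v (X t *v v))"
        using W_blk_sym[OF t] by (metis symmetric_inner inner_commute)+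
      then show ?thesis unfolding D_def
        using *[of v u] *[of u v]
        by (intro has_vector_derivative_eq_rhs[OF has_vector_derivative_diff[OF
              bounded_bilinear.has_vector_derivative[OF bounded_bilinear_inner h(1,2)]
              bounded_bilinear.has_vector_derivative[OF bounded_bilinear_inner h(2,1)]]])
          (simp add: inner_add_right inner_add_left inner_diff_right inner_diff_left
            inner_matrix_vector_transpose[of _ "transpose (A t)"] inner_commute)
    qed
    then have "D t = 0"
      by (rule zero_of_derivative_bound[where L=0]) (use t in \<open>auto simp: D_def LT\<close>)
    then show ?thesis by (simp add: D_def)
  qed
  have Ysym: "transpose (Y t) = Y t" if t: "t \<in> {0..T}" for t
  proof -
    have "v \<bullet> (Y t *v u) = (Y t *v v) \<bullet> u" for u v
      using sym[OF t, of "matrix_inv (X t) *v v" "matrix_inv (X t) *v u"]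
      by (simp add: Xv[OF t] Y_def flip: matrix_vector_mul_assoc)
    then have "(transpose (Y t) *v v) \<bullet> u = (Y t *v v) \<bullet> u" for u v
      by (simp add: inner_matrix_vector_transpose)
    then show ?thesis by (metis matrix_eq vector_eq_rdot)
  qed
  have "(Y has_vector_derivative
        (- (transpose (A t) ** Y t + Y t ** A t + Q t
            - (Y t ** B t + S t) ** matrix_inv (R t) ** transpose (Y t ** B t + S t))))
        (at t within {0..T})" if t: "t \<in> {0..T}" for t
  proof -
    have "(Y has_vector_derivative
        L t ** - (matrix_inv (X t) ** (A t ** X t + B t ** U t) ** matrix_inv (X t))
        + - (transpose (A t) ** L t + Q t ** X t + S t ** U t) ** matrix_inv (X t)) (at t within {0..T})"
      unfolding Y_def
      by (intro bounded_bilinear.has_vector_derivative[OF mm] L t has_vector_derivative_matrix_inv[OF X inv])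
    \<comment> \<open>The two expressions are compared on a vector \<open>v\<close>. With
      \<open>\<xi>\<close> chosen so that \<open>X t *v \<xi> = v\<close>, the control
      \<open>U t *v \<xi>\<close> becomes the feedback \<open>- z\<close>.\<close>
    moreover have "(L t ** - (matrix_inv (X t) ** (A t ** X t + B t ** U t) ** matrix_inv (X t))
        + - (transpose (A t) ** L t + Q t ** X t + S t ** U t) ** matrix_inv (X t)) *v v
      = (- (transpose (A t) ** Y t + Y t ** A t + Q t
            - (Y t ** B t + S t) ** matrix_inv (R t) ** transpose (Y t ** B t + S t))) *v v" for v
    proof -
      define \<xi> where "\<xi> = matrix_inv (X t) *v v"
      have LY: "L t *v (matrix_inv (X t) *v u) = Y t *v u" for u
        by (simp add: Y_def matrix_vector_mul_assoc)
      define z where "z = matrix_inv (R t) *v (transpose (Y t ** B t + S t) *v v)"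
      have u: "U t *v \<xi> = - z"
        unfolding hamiltonian_flow_vector(3)[OF H t] \<xi>_def z_def transpose_mult_add_vector[OF Ysym[OF t]] Xv[OF t] LY ..
      note mv_simps = matrix_vector_mult_add_rdistrib bounded_bilinear.minus_left[OF mv]
        bounded_bilinear.diff_left[OF mv] bounded_bilinear.add_right[OF mv]
        bounded_bilinear.minus_right[OF mv] bounded_bilinear.diff_right[OF mv]
      show ?thesis
        by (simp add: mv_simps Xv[OF t] LY u[unfolded \<xi>_def] flip: matrix_vector_mul_assoc z_def)
    qed
    ultimately show ?thesis by (metis (no_types, lifting) matrix_eq)
  qed
  moreover have "Y T = 0" by (simp add: Y_def LT bounded_bilinear.zero_left[OF mm])
  ultimately show ?thesis unfolding riccati_sol_def by blast
qed

text \<open>\<open>riccati_sol\<close> does not include symmetry, and the theorem speaks of every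
  solution. The quadratic term is symmetric for any \<open>Y\<close>, so \<open>Y\<close> minus its
  transpose solves a homogeneous linear equation with value 0 at \<open>T\<close>.\<close>

lemma riccati_sol_symmetric:
  assumes Y: "riccati_sol T A B W Y" and t: "t \<in> {0..T}"
  shows "transpose (Y t) = Y t"
proof -
  note mm = bounded_bilinear_matrix_matrix_mult
  note tr = bounded_linear_transpose
  define Y' where "Y' t = - (transpose (A t) ** Y t + Y t ** A t + Q t
      - (Y t ** B t + S t) ** matrix_inv (R t) ** transpose (Y t ** B t + S t))" for t
  have Yd: "(Y has_vector_derivative Y' t) (at t within {0..T})" if "t \<in> {0..T}" for t
    using Y that unfolding riccati_sol_def Y'_def by blast
  define D where "D t = Y t - transpose (Y t)" for t
  have D': "Y' t - transpose (Y' t) = - (transpose (A t) ** D t + D t ** A t)" if t: "t \<in> {0..T}" for t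
  proof -
    have "transpose (matrix_inv (R t)) = matrix_inv (R t)"
      by (intro transpose_matrix_inv neg_def_invertible R_neg W_blk_sym t)
    then have "transpose (Y' t) = - (transpose (Y t) ** A t + transpose (A t) ** transpose (Y t) + Q t
      - (Y t ** B t + S t) ** matrix_inv (R t) ** transpose (Y t ** B t + S t))"
      by (simp add: Y'_def linear_add[OF bounded_linear.linear[OF tr]] linear_diff[OF bounded_linear.linear[OF tr]]
        linear_neg[OF bounded_linear.linear[OF tr]] matrix_transpose_mul W_blk_sym[OF t] matrix_mul_assoc)
    then show ?thesis
      by (simp add: Y'_def D_def bounded_bilinear.diff_left[OF mm] bounded_bilinear.diff_right[OF mm])
  qed
  obtain L where L: "L > 0" "\<And>t v. t \<in> {0..T} \<Longrightarrow>
      norm (- (transpose (A t) ** v + v ** A t)) \<le> L * norm (v :: real^'s^'s)"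
  proof (rule linear_family_bound[of "{0..T}" "\<lambda>t v. - (transpose (A t) ** v + v ** A t)"])
    show "linear (\<lambda>v. - (transpose (A t) ** v + v ** A t))" for t
      by (rule linearI) (simp_all add: bounded_bilinear.add_left[OF mm] bounded_bilinear.add_right[OF mm]
          bounded_bilinear.scaleR_left[OF mm] bounded_bilinear.scaleR_right[OF mm] scaleR_diff_right)
    show "continuous_on {0..T} (\<lambda>t. - (transpose (A t) ** v + v ** A t))" for v
      by (intro continuous_intros continuous_on_matrix_intros A_cont)
  qed auto
  have "D t = 0"
  proof (rule zero_of_derivative_bound[where D=D, OF _ _ _ t])
    fix t assume t: "t \<in> {0..T}"
    show "(D has_vector_derivative - (transpose (A t) ** D t + D t ** A t)) (at t within {0..T})"
      unfolding D'[OF t, symmetric] unfolding D_def[abs_def]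
      by (rule has_vector_derivative_diff[OF Yd[OF t] bounded_linear.has_vector_derivative[OF tr Yd[OF t]]])
    show "norm (- (transpose (A t) ** D t + D t ** A t)) \<le> L * norm (D t)" by (rule L(2)[OF t])
  next
    show "D T = 0"
      using Y by (simp add: D_def riccati_sol_def linear_0[OF bounded_linear.linear[OF tr]])
  qed
  then show ?thesis by (simp add: D_def)
qed

end

section \<open>Completing the square\<close>

locale lq_riccati = lq_problem T A B W
  for T and A :: "real \<Rightarrow> real^('s::finite)^'s" and B :: "real \<Rightarrow> real^('w::finite)^'s" and W +
  fixes Y :: "real \<Rightarrow> real^'s^'s"
  assumes Y: "riccati_sol T A B W Y"
begin

definition K where "K t = matrix_inv (R t) ** transpose (Y t ** B t + S t)"
definition Y' where "Y' t = - (transpose (A t) ** Y t + Y t ** A t + Q t - (Y t ** B t + S t) ** K t)"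

lemma Y_T: "Y T = 0" using Y by (simp add: riccati_sol_def)

lemma Y_deriv: "t \<in> {0..T} \<Longrightarrow> (Y has_vector_derivative Y' t) (at t within {0..T})"
  using Y unfolding riccati_sol_def Y'_def K_def by (simp add: matrix_mul_assoc)

lemmas Y_sym = riccati_sol_symmetric[OF Y]

lemma Y_cont: "continuous_on {0..T} Y"
  by (rule has_vector_derivative_imp_continuous_on[OF Y_deriv])

lemma K_cont: "continuous_on {0..T} K"
  unfolding K_def
  by (intro continuous_intros continuous_on_matrix_intros R_inv_cont Y_cont B_cont W_cont)

lemma Y'_cont: "continuous_on {0..T} Y'"
  unfolding Y'_def
  by (intro continuous_intros continuous_on_matrix_intros K_cont Y_cont A_cont B_cont W_cont)

text \<open>Completing the square: R K = G^T with G = Y B + S, the Riccati equation cancels the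
  terms in \<open>A\<close> and \<open>Q\<close> and leaves
  \<open>x \<bullet> (G *v (K t *v x))\<close>, and the cross terms combine to twice
  \<open>x \<bullet> (G *v w)\<close>.\<close>

lemma dissipation_riccati:
  assumes t: "t \<in> {0..T}"
  shows "dissipation (A t) (B t) (W t) (Y t) (Y' t) x w = (w + K t *v x) \<bullet> (R t *v (w + K t *v x))"
proof -
  note mv = bounded_bilinear_matrix_vector_mult
  define G where "G = Y t ** B t + S t"
  have RK: "R t *v (K t *v x) = transpose G *v x"
    unfolding K_def G_def by (simp add: R_mult_inv[OF t] flip: matrix_vector_mul_assoc)
  have "(K t *v x) \<bullet> (R t *v w) = (R t *v (K t *v x)) \<bullet> w"
    by (rule symmetric_inner) (rule W_blk_sym[OF t])
  also have "\<dots> = x \<bullet> (G *v w)" unfolding RK by (rule inner_matrix_vector_transpose[symmetric])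
  finally have KRw: "(K t *v x) \<bullet> (R t *v w) = x \<bullet> (G *v w)" .
  have wG: "w \<bullet> (transpose G *v x) = x \<bullet> (G *v w)" for w
    by (simp add: inner_matrix_vector_transpose[of w] inner_commute)
  have "x \<bullet> (Y' t *v x) = - 2 * ((A t *v x) \<bullet> (Y t *v x)) - x \<bullet> (Q t *v x) + x \<bullet> (G *v (K t *v x))"
  proof -
    have "x \<bullet> (transpose (A t) *v (Y t *v x)) = (A t *v x) \<bullet> (Y t *v x)"
      by (simp add: inner_matrix_vector_transpose[of x "transpose (A t)"])
    moreover have "x \<bullet> (Y t *v (A t *v x)) = (A t *v x) \<bullet> (Y t *v x)"
      unfolding symmetric_inner[OF Y_sym[OF t], of x] by (rule inner_commute)
    ultimately show ?thesis
      unfolding Y'_def G_def[symmetric]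
      by (simp add: bounded_bilinear.minus_left[OF mv] matrix_vector_mult_add_rdistrib
        matrix_vector_mult_diff_rdistrib inner_diff_right inner_add_right flip: matrix_vector_mul_assoc)
  qed
  moreover have "x \<bullet> (G *v w) = (B t *v w) \<bullet> (Y t *v x) + x \<bullet> (S t *v w)"
  proof -
    have "x \<bullet> (Y t *v (B t *v w)) = (B t *v w) \<bullet> (Y t *v x)"
      unfolding symmetric_inner[OF Y_sym[OF t], of x] by (rule inner_commute)
    then show ?thesis
      by (simp add: G_def matrix_vector_mult_add_rdistrib inner_add_right flip: matrix_vector_mul_assoc)
  qed
  moreover have "(w + K t *v x) \<bullet> (R t *v (w + K t *v x))
      = w \<bullet> (R t *v w) + 2 * (x \<bullet> (G *v w)) + x \<bullet> (G *v (K t *v x))"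
    by (simp add: matrix_vector_right_distrib inner_add_left inner_add_right RK KRw wG)
  ultimately show ?thesis
    by (simp add: dissipation_def symmetric_stack_form[OF W_sym[OF t]] inner_add_left)
qed

end

section \<open>Cost of square-integrable controls\<close>

lemma absolutely_integrable_of_square:
  fixes w :: "real \<Rightarrow> 'a::euclidean_space"
  assumes w: "w measurable_on {a..b}" "(\<lambda>t. (norm (w t))\<^sup>2) integrable_on {a..b}"
  shows "w absolutely_integrable_on {a..b}"
proof (rule measurable_bounded_by_integrable_imp_absolutely_integrable)
  show "w \<in> borel_measurable (lebesgue_on {a..b})"
    using w(1) by (simp add: measurable_on_iff_borel_measurable)
  show "(\<lambda>t. 1 + (norm (w t))\<^sup>2) integrable_on {a..b}"
    by (intro integrable_add w(2) integrable_const_ivl)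
  show "norm (w t) \<le> 1 + (norm (w t))\<^sup>2" for t
    using zero_le_power2[of "norm (w t) - 1"] norm_ge_zero[of "w t"]
    unfolding power2_diff power_one mult_1_right by linarith
qed auto

lemma quadratic_form_absolutely_integrable:
  fixes w :: "real \<Rightarrow> real^'n::finite"
  assumes N: "continuous_on {a..b} N"
    and w: "w measurable_on {a..b}" "(\<lambda>t. (norm (w t))\<^sup>2) integrable_on {a..b}"
  shows "(\<lambda>t. w t \<bullet> (N t *v w t)) absolutely_integrable_on {a..b}"
proof -
  have "bounded (N ` {a..b})" by (intro compact_imp_bounded compact_continuous_image N) simp
  then obtain c where c: "\<And>t. t \<in> {a..b} \<Longrightarrow> norm (N t) \<le> c"
    unfolding bounded_iff by blast
  obtain k where k: "\<And>M (v :: real^'n). norm ((M :: real^'n^'n) *v v) \<le> norm M * norm v * k"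
    and k0: "k > 0"
    using bounded_bilinear.pos_bounded[OF bounded_bilinear_matrix_vector_mult] by blast
  show ?thesis
  proof (rule measurable_bounded_by_integrable_imp_absolutely_integrable)
    have wm: "w \<in> borel_measurable (lebesgue_on {a..b})"
      using w(1) by (simp add: measurable_on_iff_borel_measurable)
    have "(\<lambda>t. N t *v w t) \<in> borel_measurable (lebesgue_on {a..b})"
      by (rule borel_measurable_bilinear[OF _ continuous_imp_measurable_on_sets_lebesgue[OF N] wm])
        (simp_all add: bilinear_conv_bounded_bilinear bounded_bilinear_matrix_vector_mult)
    with wm show "(\<lambda>t. w t \<bullet> (N t *v w t)) \<in> borel_measurable (lebesgue_on {a..b})"
      by (rule borel_measurable_inner)
    show "(\<lambda>t. (c * k) * (norm (w t))\<^sup>2) integrable_on {a..b}"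
      using w(2) by (rule integrable_on_mult_right)
    fix t assume t: "t \<in> {a..b}"
    have "norm (w t \<bullet> (N t *v w t)) \<le> norm (w t) * norm (N t *v w t)"
      by (simp add: Cauchy_Schwarz_ineq2)
    also have "\<dots> \<le> norm (w t) * (norm (N t) * norm (w t) * k)"
      by (intro mult_left_mono k) simp
    also have "\<dots> \<le> norm (w t) * (c * norm (w t) * k)"
      using c[OF t] k0 by (intro mult_left_mono mult_right_mono) auto
    finally show "norm (w t \<bullet> (N t *v w t)) \<le> (c * k) * (norm (w t))\<^sup>2"
      by (simp add: power2_eq_square mult_ac)
  qed auto
qed

context lq_riccati
begin

lemma closed_loop_exists:
  "\<exists>x. x 0 = x0 \<and> (\<forall>t\<in>{0..T}. (x has_vector_derivative (A t - B t ** K t) *v x t) (at t within {0..T}))"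
proof (rule linear_ode_exists)
  show "continuous_on {0..T} (\<lambda>t. (A t - B t ** K t) *v v)" for v
    by (intro continuous_intros continuous_on_matrix_intros A_cont B_cont K_cont)
qed (use T_pos in auto)

text \<open>For a square-integrable control the state is only an indefinite integral and need not be
  differentiable everywhere. The product rule for indefinite integrals is therefore applied twice,
  first to \<open>Y\<close> and \<open>x\<close>, then to \<open>x\<close> and \<open>Y x\<close>;
  \<open>Y T = 0\<close> removes the terminal term.\<close>

lemma cost_completed_square:
  assumes traj: "lq_traj T A B x0 x w"
  shows "lq_cost T W x w = x0 \<bullet> (Y 0 *v x0)
    + integral {0..T} (\<lambda>t. (w t + K t *v x t) \<bullet> (R t *v (w t + K t *v x t)))"
proof -
  note mv = bounded_bilinear_matrix_vector_mult
  define f where "f t = A t *v x t + B t *v w t" for t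
  have w: "w measurable_on {0..T}" "(\<lambda>t. (norm (w t))\<^sup>2) integrable_on {0..T}"
    and f_int: "f integrable_on {0..T}" and x: "\<And>t. t \<in> {0..T} \<Longrightarrow> x t = x0 + integral {0..t} f"
    using traj unfolding lq_traj_def f_def by auto
  have xc: "continuous_on {0..T} x"
    by (rule continuous_on_eq[where f="\<lambda>t. x0 + integral {0..t} f"])
      (auto intro!: continuous_intros indefinite_integral_continuous_1 f_int simp: x)
  have wi: "w absolutely_integrable_on {0..T}" by (rule absolutely_integrable_of_square[OF w])
  have fi: "f absolutely_integrable_on {0..T}"
    unfolding f_def
    by (intro set_integral_add(1) bounded_bilinear_absolutely_integrable[OF mv B_cont wi]
        absolutely_integrable_continuous_real continuous_on_matrix_intros A_cont xc)
  have x0: "x 0 = x0" using x[of 0] T_pos by simp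
  define g where "g t = Y t *v f t + Y' t *v x t" for t
  have y: "Y t *v x t = Y 0 *v x0 + integral {0..t} g" and gi: "g absolutely_integrable_on {0..t}"
    if t: "t \<in> {0..T}" for t
  proof -
    have Yi: "Y s = Y 0 + integral {0..s} Y'" if "s \<in> {0..t}" for s
    proof -
      have "(Y' has_integral Y s - Y 0) {0..s}"
        by (rule fundamental_theorem_of_calculus)
          (use that t in \<open>auto intro: has_vector_derivative_within_subset[OF Y_deriv]\<close>)
      then show ?thesis by (simp add: integral_unique)
    qed
    have Y'i: "Y' absolutely_integrable_on {0..t}"
      by (intro absolutely_integrable_continuous_real continuous_on_subset[OF Y'_cont]) (use t in auto)
    have fi': "f absolutely_integrable_on {0..t}"
      by (rule set_integrable_subset[OF fi]) (use t in auto)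
    have xi: "x s = x0 + integral {0..s} f" if "s \<in> {0..t}" for s
      using x[of s] that t by auto
    note pr = indefinite_integral_product_rule[OF mv _ Y'i fi' Yi xi]
    show "g absolutely_integrable_on {0..t}" "Y t *v x t = Y 0 *v x0 + integral {0..t} g"
      using pr t x0 unfolding g_def[abs_def] by auto
  qed
  have T: "T \<in> {0..T}" using T_pos by simp
  \<comment> \<open>The integrand whose primitive is \<open>x \<bullet> Y x\<close>; its integral
    over the horizon is minus the initial value of that form.\<close>
  define \<phi> where "\<phi> t = x t \<bullet> g t + f t \<bullet> (Y t *v x t)" for t
  note pr = indefinite_integral_product_rule[OF bounded_bilinear_inner _ fi gi[OF T] x y]
  have \<phi>i: "\<phi> integrable_on {0..T}" and \<phi>: "x0 \<bullet> (Y 0 *v x0) + integral {0..T} \<phi> = 0"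
    using pr T_pos unfolding \<phi>_def[abs_def] Y_T x0
    by (auto simp: absolutely_integrable_on_def bounded_bilinear.zero_left[OF mv])
  let ?c = "\<lambda>t. stack (x t) (w t) \<bullet> (W t *v stack (x t) (w t))"
  \<comment> \<open>Integrability of the running cost is what permits splitting the integral of the
    square into cost plus the integral of \<open>\<phi>\<close>.\<close>
  have ci: "?c integrable_on {0..T}"
  proof -
    have "(\<lambda>t. x t \<bullet> (Q t *v x t) + 2 * (x t \<bullet> (S t *v w t)) + w t \<bullet> (R t *v w t)) absolutely_integrable_on {0..T}"
      by (intro set_integral_add(1) set_integrable_mult_right quadratic_form_absolutely_integrable
          bounded_bilinear_absolutely_integrable[OF bounded_bilinear_inner xc]
          bounded_bilinear_absolutely_integrable[OF mv _ wi]
          absolutely_integrable_continuous_real continuous_intros continuous_on_matrix_intros xc W_cont w)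
    then show ?thesis
      by (rule integrable_eq[OF set_lebesgue_integral_eq_integral(1)])
        (simp add: symmetric_stack_form[OF W_sym])
  qed
  have "integral {0..T} (\<lambda>t. (w t + K t *v x t) \<bullet> (R t *v (w t + K t *v x t)))
      = integral {0..T} (\<lambda>t. ?c t + \<phi> t)"
  proof (rule integral_cong)
    fix t assume t: "t \<in> {0..T}"
    have "x t \<bullet> (Y t *v f t) = f t \<bullet> (Y t *v x t)"
      unfolding symmetric_inner[OF Y_sym[OF t], of "x t"] by (rule inner_commute)
    then show "(w t + K t *v x t) \<bullet> (R t *v (w t + K t *v x t)) = ?c t + \<phi> t"
      unfolding dissipation_riccati[OF t, symmetric]
      by (simp add: dissipation_def \<phi>_def g_def inner_add_right flip: f_def)
  qed
  also have "\<dots> = lq_cost T W x w + integral {0..T} \<phi>"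
    unfolding lq_cost_def by (rule integral_add[OF ci \<phi>i])
  finally show ?thesis using \<phi> by simp
qed

lemma R_nonpos: "t \<in> {0..T} \<Longrightarrow> v \<bullet> (R t *v v) \<le> 0"
  using R_neg[of t] unfolding neg_def_def by (cases "v = 0") (auto intro: less_imp_le)

lemma cost_le:
  assumes "lq_traj T A B x0 x w"
  shows "lq_cost T W x w \<le> x0 \<bullet> (Y 0 *v x0)"
proof -
  have "integral {0..T} (\<lambda>t. (w t + K t *v x t) \<bullet> (R t *v (w t + K t *v x t))) \<le> 0"
  proof (cases "(\<lambda>t. (w t + K t *v x t) \<bullet> (R t *v (w t + K t *v x t))) integrable_on {0..T}")
    case True
    then show ?thesis using integral_le[OF True integrable_0 R_nonpos] by simp
  \<comment> \<open>The integral of a non-integrable function is 0 by convention, which also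
    satisfies the bound.\<close>
  qed (simp add: not_integrable_integral)
  then show ?thesis using cost_completed_square[OF assms] by simp
qed

context
  fixes x w
  assumes x: "\<And>t. t \<in> {0..T} \<Longrightarrow> (x has_vector_derivative (A t - B t ** K t) *v x t) (at t within {0..T})"
  defines "w \<equiv> \<lambda>t. - (K t *v x t)"
begin

lemma closed_loop_deriv:
  "t \<in> {0..T} \<Longrightarrow> (x has_vector_derivative A t *v x t + B t *v w t) (at t within {0..T})"
  using x[of t] by (simp add: w_def matrix_vector_mult_diff_rdistrib matrix_vector_mul_assoc
    bounded_bilinear.minus_right[OF bounded_bilinear_matrix_vector_mult])

lemma closed_loop_cont: "continuous_on {0..T} x" "continuous_on {0..T} w"
proof -
  show "continuous_on {0..T} x" by (rule has_vector_derivative_imp_continuous_on[OF x])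
  then show "continuous_on {0..T} w"
    unfolding w_def by (intro continuous_intros continuous_on_matrix_intros K_cont)
qed

lemma closed_loop_traj: "lq_traj T A B (x 0) x w"
  by (rule lq_traj_of_derivative[OF A_cont B_cont closed_loop_deriv closed_loop_cont(2)])

lemma closed_loop_cost: "lq_cost T W x w = x 0 \<bullet> (Y 0 *v x 0)"
  using cost_completed_square[OF closed_loop_traj]
  by (simp add: w_def)

end

section \<open>The value of the LMI infimum\<close>

lemma riccati_le_lmi_feasible:
  assumes P: "lmi_feasible T A B W P"
  shows "x0 \<bullet> (Y 0 *v x0) \<le> x0 \<bullet> (P 0 *v x0)"
proof -
  obtain x where x0: "x 0 = x0"
    and x: "\<And>t. t \<in> {0..T} \<Longrightarrow> (x has_vector_derivative (A t - B t ** K t) *v x t) (at t within {0..T})"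
    using closed_loop_exists by blast
  show ?thesis
    using cost_le_of_lmi_feasible[OF _ W_cont P closed_loop_deriv[OF x] closed_loop_cont(2)[OF x]]
      closed_loop_cost[OF x] T_pos x0 by simp
qed

text \<open>\<open>Y\<close> alone is not strictly feasible, since its dissipation vanishes at
  \<open>w = - (K t *v x)\<close>; any positive share \<open>e\<close> of \<open>P\<close> restores
  strictness.\<close>

lemma lmi_feasible_convex_combination:
  assumes P: "lmi_feasible T A B W P" and e: "0 < e" "e \<le> 1"
  shows "lmi_feasible T A B W (\<lambda>t. (1 - e) *\<^sub>R Y t + e *\<^sub>R P t)"
proof -
  note mv = bounded_bilinear_matrix_vector_mult
  obtain P' where P: "\<And>t. t \<in> {0..T} \<Longrightarrow> (P has_vector_derivative P' t) (at t within {0..T})"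
    "\<And>t. t \<in> {0..T} \<Longrightarrow> transpose (P t) = P t" "psd (P T)"
    "\<And>t x w. t \<in> {0..T} \<Longrightarrow> x \<noteq> 0 \<or> w \<noteq> 0 \<Longrightarrow> dissipation (A t) (B t) (W t) (P t) (P' t) x w < 0"
    using P unfolding lmi_feasible_iff by metis
  show ?thesis
    unfolding lmi_feasible_iff
  proof (intro exI[of _ "\<lambda>t. (1 - e) *\<^sub>R Y' t + e *\<^sub>R P' t"] conjI ballI allI impI)
    fix t assume t: "t \<in> {0..T}"
    show "((\<lambda>t. (1 - e) *\<^sub>R Y t + e *\<^sub>R P t) has_vector_derivative (1 - e) *\<^sub>R Y' t + e *\<^sub>R P' t) (at t within {0..T})"
      by (intro has_vector_derivative_add bounded_linear.has_vector_derivative[OF bounded_linear_scaleR_right]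
          Y_deriv P t)
    show "transpose ((1 - e) *\<^sub>R Y t + e *\<^sub>R P t) = (1 - e) *\<^sub>R Y t + e *\<^sub>R P t"
      by (simp add: linear_add[OF bounded_linear.linear[OF bounded_linear_transpose]]
          linear_scale[OF bounded_linear.linear[OF bounded_linear_transpose]] Y_sym[OF t] P(2)[OF t])
    fix x :: "real^'s" and w :: "real^'w" assume nz: "x \<noteq> 0 \<or> w \<noteq> 0"
    have "dissipation (A t) (B t) (W t) (Y t) (Y' t) x w \<le> 0"
      unfolding dissipation_riccati[OF t] by (rule R_nonpos[OF t])
    then have "(1 - e) * dissipation (A t) (B t) (W t) (Y t) (Y' t) x w \<le> 0"
      using e by (simp add: mult_nonneg_nonpos)
    moreover have "e * dissipation (A t) (B t) (W t) (P t) (P' t) x w < 0"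
      using e P(4)[OF t nz] by (simp add: mult_pos_neg)
    moreover have "dissipation (A t) (B t) (W t) ((1 - e) *\<^sub>R Y t + e *\<^sub>R P t) ((1 - e) *\<^sub>R Y' t + e *\<^sub>R P' t) x w
      = (1 - e) * dissipation (A t) (B t) (W t) (Y t) (Y' t) x w + e * dissipation (A t) (B t) (W t) (P t) (P' t) x w"
      by (simp add: dissipation_def bounded_bilinear.add_left[OF mv] bounded_bilinear.scaleR_left[OF mv]
          inner_add_right algebra_simps)
    ultimately show "dissipation (A t) (B t) (W t) ((1 - e) *\<^sub>R Y t + e *\<^sub>R P t) ((1 - e) *\<^sub>R Y' t + e *\<^sub>R P' t) x w < 0"
      by linarith
  next
    show "psd ((1 - e) *\<^sub>R Y T + e *\<^sub>R P T)"
      using P(3) e by (simp add: psd_def Y_T bounded_bilinear.scaleR_left[OF mv])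
  qed
qed

lemma lmi_infimum:
  assumes P: "lmi_feasible T A B W P"
  shows "Inf {ereal (x0 \<bullet> (P 0 *v x0)) | P. lmi_feasible T A B W P} = ereal (x0 \<bullet> (Y 0 *v x0))"
proof (rule antisym)
  note mv = bounded_bilinear_matrix_vector_mult
  let ?y = "x0 \<bullet> (Y 0 *v x0)" and ?p = "x0 \<bullet> (P 0 *v x0)"
  show "ereal ?y \<le> Inf {ereal (x0 \<bullet> (P 0 *v x0)) | P. lmi_feasible T A B W P}"
    by (rule Inf_greatest) (auto intro: riccati_le_lmi_feasible)
  show "Inf {ereal (x0 \<bullet> (P 0 *v x0)) | P. lmi_feasible T A B W P} \<le> ereal ?y"
  proof (rule ereal_le_epsilon2)
    fix d :: real assume d: "d > 0"
    \<comment> \<open>Chosen so that moving from \<open>Y\<close> towards \<open>P\<close> raises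
      the value by at most \<open>d\<close>; the added 1 keeps the denominator positive.\<close>
    define e where "e = min 1 (d / (\<bar>?p - ?y\<bar> + 1))"
    have e: "0 < e" "e \<le> 1" using d by (auto simp: e_def)
    have "e * (?p - ?y) \<le> e * (\<bar>?p - ?y\<bar> + 1)" using e by (intro mult_left_mono) auto
    also have "\<dots> \<le> d / (\<bar>?p - ?y\<bar> + 1) * (\<bar>?p - ?y\<bar> + 1)" by (intro mult_right_mono) (auto simp: e_def)
    finally have "e * (?p - ?y) \<le> d" by simp
    then have le: "x0 \<bullet> (((1 - e) *\<^sub>R Y 0 + e *\<^sub>R P 0) *v x0) \<le> ?y + d"
      by (simp add: bounded_bilinear.add_left[OF mv] bounded_bilinear.scaleR_left[OF mv]
          inner_add_right algebra_simps)
    have "Inf {ereal (x0 \<bullet> (P 0 *v x0)) | P. lmi_feasible T A B W P}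
        \<le> ereal (x0 \<bullet> (((1 - e) *\<^sub>R Y 0 + e *\<^sub>R P 0) *v x0))"
      by (rule Inf_lower, intro CollectI exI[of _ "\<lambda>t. (1 - e) *\<^sub>R Y t + e *\<^sub>R P t"])
        (simp add: lmi_feasible_convex_combination[OF P e])
    also have "\<dots> \<le> ereal ?y + ereal d" using le by simp
    finally show "Inf {ereal (x0 \<bullet> (P 0 *v x0)) | P. lmi_feasible T A B W P} \<le> ereal ?y + ereal d" .
  qed
qed

end

section \<open>Dependence on the multiplier\<close>

lemma bounded_linear_hcat: "bounded_linear (\<lambda>p. hcat (fst p) (snd p))"
  unfolding linear_conv_bounded_linear[symmetric]
  by (auto intro!: linearI simp: hcat_def vec_eq_iff split: sum.split)

lemma continuous_on_blk:
  assumes "continuous_on D P" "continuous_on D Q"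
  shows "continuous_on D (\<lambda>t. blk (P t) (Q t) R S)"
proof (intro continuous_on_vec_componentwise)
  show "continuous_on D (\<lambda>t. blk (P t) (Q t) R S $ i $ j)" for i j
    unfolding blk_def by (cases i; cases j) (auto intro!: continuous_intros assms)
qed

lemma continuous_on_W0:
  assumes "continuous_on D C" "continuous_on D E"
  shows "continuous_on D (W0 C E)"
  using bounded_linear.continuous_on[OF bounded_linear_hcat continuous_on_Pair[OF assms]]
  unfolding W0_def[abs_def] by (intro continuous_on_matrix_intros) auto

lemma continuous_on_Wi:
  assumes "continuous_on D C" "continuous_on D E"
  shows "continuous_on D (Wi C E M i)"
  unfolding Wi_def[abs_def]
  by (intro continuous_on_matrix_intros continuous_on_blk continuous_on_const assms)

lemma continuous_on_Wlam:
  assumes "continuous_on D C" "continuous_on D E" "continuous_on D C'" "continuous_on D E'"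
  shows "continuous_on D (Wlam C E C' E' M \<alpha>)"
  unfolding Wlam_def[abs_def]
  by (intro continuous_intros continuous_on_W0 continuous_on_Wi assms)

lemma transpose_Wlam:
  assumes "\<And>i. transpose (M i) = M i"
  shows "transpose (Wlam C E C' E' M \<alpha> t) = Wlam C E C' E' M \<alpha> t"
proof -
  note lin = bounded_linear.linear[OF bounded_linear_transpose]
  have "transpose (W0 C E t) = W0 C E t" by (simp add: W0_def matrix_transpose_mul)
  moreover have "transpose (Wi C' E' M i t) = Wi C' E' M i t" for i
    by (simp add: Wi_def matrix_transpose_mul assms matrix_mul_assoc)
  ultimately show ?thesis
    by (simp add: Wlam_def linear_add[OF lin] linear_sum[OF lin] linear_scale[OF lin])
qed

text \<open>Along a fixed trajectory the cost is affine in the multiplier, and the costs of the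
  individual \<open>Wi\<close> form its slope, the subgradient of the theorem.\<close>

lemma lq_cost_Wlam_diff:
  assumes c: "continuous_on {0..T} C" "continuous_on {0..T} E" "continuous_on {0..T} C'" "continuous_on {0..T} E'"
    and xw: "continuous_on {0..T} x" "continuous_on {0..T} w"
  shows "lq_cost T (Wlam C E C' E' M \<alpha>) x w
    = lq_cost T (Wlam C E C' E' M \<beta>) x w + (\<chi> i. lq_cost T (Wi C' E' M i) x w) \<bullet> (\<alpha> - \<beta>)"
proof -
  note mv = bounded_bilinear_matrix_vector_mult
  let ?q = "\<lambda>W t. stack (x t) (w t) \<bullet> (W t *v stack (x t) (w t))"
  have int: "?q W integrable_on {0..T}" if "continuous_on {0..T} W" for W
    by (intro integrable_continuous_real continuous_intros continuous_on_matrix_intros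
        continuous_on_stack xw that)
  note i0 = int[OF continuous_on_W0[OF c(1,2)]] and i = int[OF continuous_on_Wi[OF c(3,4)]]
  have "lq_cost T (Wlam C E C' E' M \<gamma>) x w
      = lq_cost T (W0 C E) x w + (\<Sum>i\<in>UNIV. \<gamma> $ i * lq_cost T (Wi C' E' M i) x w)" for \<gamma>
  proof -
    have "?q (Wlam C E C' E' M \<gamma>) = (\<lambda>t. ?q (W0 C E) t + (\<Sum>i\<in>UNIV. \<gamma> $ i * ?q (Wi C' E' M i) t))"
      by (simp add: Wlam_def bounded_bilinear.add_left[OF mv] bounded_bilinear.sum_left[OF mv]
          bounded_bilinear.scaleR_left[OF mv] inner_add_right inner_sum_right)
    then show ?thesis
      unfolding lq_cost_def
      by (simp add: integral_add i0 i integrable_sum integrable_on_mult_right integral_sum)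
  qed
  note eq = this
  show ?thesis
    unfolding eq by (simp add: inner_vec_def sum_subtractf algebra_simps)
qed

section \<open>The optimal value, the optimal feedback and the subgradient inequality\<close>

theorem theorem3:
  fixes T :: real
    and Aa :: "real \<Rightarrow> real^('x::finite+unit)^('x+unit)"
    and Ba :: "real \<Rightarrow> real^('w::finite)^('x+unit)"
    and Cva :: "real \<Rightarrow> real^('x+unit)^('v::finite)"
    and Dvw :: "real \<Rightarrow> real^'w^'v"
    and Cea :: "real \<Rightarrow> real^('x+unit)^('e::finite)"
    and Dew :: "real \<Rightarrow> real^'w^'e"
    and M :: "'m::finite \<Rightarrow> real^('v+'w)^('v+'w)"
    and lam :: "real^'m"
  assumes T_pos: "0 < T"
    and cont: "continuous_on {0..T} Aa" "continuous_on {0..T} Ba"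
              "continuous_on {0..T} Cva" "continuous_on {0..T} Dvw"
              "continuous_on {0..T} Cea" "continuous_on {0..T} Dew"
    and M_sym: "\<And>i. transpose (M i) = M i"
    and R_neg: "\<forall>t\<in>{0..T}. neg_def (blk22 (Wlam Cea Dew Cva Dvw M lam t))"
    and J_fin: "Jval T Aa Ba (Wlam Cea Dew Cva Dvw M lam) < \<infinity>"
  shows
    "(SUP xw \<in> {(x, w). lq_traj T Aa Ba x0a x w}.
        ereal (lq_cost T (Wlam Cea Dew Cva Dvw M lam) (fst xw) (snd xw)))
       = Jval T Aa Ba (Wlam Cea Dew Cva Dvw M lam)
     \<and> (\<exists>Y. riccati_sol T Aa Ba (Wlam Cea Dew Cva Dvw M lam) Y)
     \<and> (\<forall>Y. riccati_sol T Aa Ba (Wlam Cea Dew Cva Dvw M lam) Y \<longrightarrow>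
          (let W = Wlam Cea Dew Cva Dvw M lam;
               K = (\<lambda>t. matrix_inv (blk22 (W t)) ** transpose (Y t ** Ba t + blk12 (W t)));
               CL = (\<lambda>xs. xs 0 = x0a \<and>
                      (\<forall>t\<in>{0..T}. (xs has_vector_derivative ((Aa t - Ba t ** K t) *v xs t))
                                     (at t within {0..T})))
           in (\<exists>xs. CL xs) \<and>
              (\<forall>xs. CL xs \<longrightarrow>
                 (let ws = (\<lambda>t. - (K t *v xs t));
                      g = (\<chi> i. lq_cost T (Wi Cva Dvw M i) xs ws)
                  in lq_traj T Aa Ba x0a xs ws
                     \<and> ereal (lq_cost T W xs ws) = Jval T Aa Ba W
                     \<and> (\<forall>\<alpha>::real^'m. Jval T Aa Ba (Wlam Cea Dew Cva Dvw M \<alpha>)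
                              \<ge> Jval T Aa Ba W + ereal (g \<bullet> (\<alpha> - lam)))))))"
proof -
  define W where "W = Wlam Cea Dew Cva Dvw M lam"
  have Wc: "continuous_on {0..T} (Wlam Cea Dew Cva Dvw M \<alpha>)" for \<alpha>
    by (intro continuous_on_Wlam cont)
  interpret lq_problem T Aa Ba W
    using T_pos cont R_neg by unfold_locales (auto simp: W_def transpose_Wlam M_sym Wc)
  \<comment> \<open>An infimum below infinity has a member below infinity, so some \<open>P\<close>
    is feasible.\<close>
  obtain P where P: "lmi_feasible T Aa Ba W P"
    using J_fin unfolding Jval_def W_def[symmetric] Inf_less_iff by blast
  obtain Y0 where Y0: "riccati_sol T Aa Ba W Y0" using riccati_sol_exists[OF P] by blast
  \<comment> \<open>One feasible \<open>P\<close> serves every Riccati solution, so all solutions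
    give the same value.\<close>
  have J: "Jval T Aa Ba W = ereal (x0a \<bullet> (Y 0 *v x0a))" if Y: "riccati_sol T Aa Ba W Y" for Y
  proof -
    interpret lq_riccati T Aa Ba W Y by unfold_locales (rule Y)
    show ?thesis unfolding Jval_def by (rule lmi_infimum[OF P])
  qed
  have closed_loop: "(\<exists>xs. xs 0 = x0a \<and> (\<forall>t\<in>{0..T}. (xs has_vector_derivative
        (Aa t - Ba t ** gain Y t) *v xs t) (at t within {0..T})))
    \<and> (\<forall>xs. xs 0 = x0a \<and> (\<forall>t\<in>{0..T}. (xs has_vector_derivative
        (Aa t - Ba t ** gain Y t) *v xs t) (at t within {0..T})) \<longrightarrow>
        lq_traj T Aa Ba x0a xs (\<lambda>t. - (gain Y t *v xs t))
        \<and> ereal (lq_cost T W xs (\<lambda>t. - (gain Y t *v xs t))) = Jval T Aa Ba W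
        \<and> (\<forall>\<alpha>. Jval T Aa Ba W + ereal ((\<chi> i. lq_cost T (Wi Cva Dvw M i) xs (\<lambda>t. - (gain Y t *v xs t))) \<bullet> (\<alpha> - lam))
            \<le> Jval T Aa Ba (Wlam Cea Dew Cva Dvw M \<alpha>)))"
    if Y: "riccati_sol T Aa Ba W Y" for Y
  proof -
    interpret lq_riccati T Aa Ba W Y by unfold_locales (rule Y)
    show ?thesis
      unfolding K_def[symmetric]
    proof (intro conjI closed_loop_exists allI impI; elim conjE)
      fix x assume x0: "x 0 = x0a"
        and x: "\<forall>t\<in>{0..T}. (x has_vector_derivative (Aa t - Ba t ** K t) *v x t) (at t within {0..T})"
      note x = x[rule_format]
      let ?w = "\<lambda>t. - (K t *v x t)"
      show "lq_traj T Aa Ba x0a x ?w" using closed_loop_traj[OF x] x0 by simp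
      show cost: "ereal (lq_cost T W x ?w) = Jval T Aa Ba W"
        using closed_loop_cost[OF x] x0 by (simp add: J[OF Y])
      fix \<alpha>
      \<comment> \<open>Weak duality at \<alpha> along the trajectory that is optimal for
        \<open>lam\<close>. If no \<open>P\<close> is feasible at \<alpha>, the infimum is infinite
        and the bound is vacuous.\<close>
      have "ereal (lq_cost T (Wlam Cea Dew Cva Dvw M \<alpha>) x ?w) \<le> Jval T Aa Ba (Wlam Cea Dew Cva Dvw M \<alpha>)"
        unfolding Jval_def
        using cost_le_of_lmi_feasible[OF less_imp_le[OF T_pos] Wc _ closed_loop_deriv[OF x] closed_loop_cont(2)[OF x]]
        by (intro Inf_greatest) (auto simp: x0)
      then show "Jval T Aa Ba W + ereal ((\<chi> i. lq_cost T (Wi Cva Dvw M i) x ?w) \<bullet> (\<alpha> - lam))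
          \<le> Jval T Aa Ba (Wlam Cea Dew Cva Dvw M \<alpha>)"
        unfolding cost[symmetric]
        using lq_cost_Wlam_diff[OF cont(5,6,3,4) closed_loop_cont[OF x], of M \<alpha> lam, folded W_def] by simp
    qed
  qed
  have "(SUP xw \<in> {(x, w). lq_traj T Aa Ba x0a x w}. ereal (lq_cost T W (fst xw) (snd xw))) = Jval T Aa Ba W"
  proof (rule antisym)
    interpret lq_riccati T Aa Ba W Y0 by unfold_locales (rule Y0)
    show "(SUP xw \<in> {(x, w). lq_traj T Aa Ba x0a x w}. ereal (lq_cost T W (fst xw) (snd xw))) \<le> Jval T Aa Ba W"
      by (rule SUP_least) (auto simp: J[OF Y0] intro: cost_le)
    obtain x w where "lq_traj T Aa Ba x0a x w" "ereal (lq_cost T W x w) = Jval T Aa Ba W"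
      using closed_loop[OF Y0] by blast
    then show "Jval T Aa Ba W \<le> (SUP xw \<in> {(x, w). lq_traj T Aa Ba x0a x w}. ereal (lq_cost T W (fst xw) (snd xw)))"
      by (intro SUP_upper2[of "(x, w)"]) auto
  qed
  then show ?thesis
    unfolding W_def[symmetric] Let_def using Y0 closed_loop by blast
qed

end
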